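(* Let $J_t(a,c)=\lim_{\Delta a\to0^+}\frac{\mathcal{K}_{a+\Delta a,c}-\mathcal{K}_{a,c}}{\Delta a}$, where $\mathcal{K}_{a,c}$ are the integral operators defined in the context. Then, with $z=e^{i\theta}$, $$\begin{aligned} &\big(J_t(a,c)\,[h(\cos\phi;-1/c,-cq)H_n(\cos\phi|q)]\big)(\cos\theta)\\ &=q^{a(a-3)/4+na/2}\Big(\frac{1-q}{2c}\Big)^a\Bigg[h(\cos\theta;-cq^{1-a/2},-q^{a/2}/c)\,\log\Big(\frac{(1-q)\,q^{(n+1)a/2-3/4}}{2c}\Big)\\ &\quad+\Big(\sum_{k=-\infty}^\infty\frac{q^{\binom k2}(zq^{a/2}/c)^k}{(q;q)_\infty}\,\frac{k\log q}{2}\Big)\Big(-\tfrac{q^{a/2}}{cz},-czq^{1-a/2};q\Big)_\infty\\ &\quad+\Big(\sum_{k=-\infty}^\infty\frac{q^{\binom k2}\big(q^{a/2}/(zc)\big)^k}{(q;q)_\infty}\,\frac{k\log q}{2}\Big)\Big(-\tfrac{q^{a/2}z}{c},-\tfrac{cq^{1-a/2}}{z};q\Big)_\infty\Bigg]H_n(\cos\theta|q). \end{aligned}$$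
   Context: Throughout $0<q<1$, $(A;q)_\infty=\prod_{k\ge0}(1-Aq^k)$, $(A_1,\dots,A_m;q)_\infty=\prod_j(A_j;q)_\infty$, and $h(\cos\theta;a_1,\dots,a_n)=\prod_{j=1}^n(a_je^{i\theta},a_je^{-i\theta};q)_\infty$. The continuous $q$-Hermite polynomials $H_n(x|q)$, $n=0,1,2,\dots$, are given by $H_0=1$, $H_1(x|q)=2x$, $2xH_n(x|q)=H_{n+1}(x|q)+(1-q^n)H_{n-1}(x|q)$. Their normalized weight is $w_H(x|q)=\frac{(q,e^{2i\theta},e^{-2i\theta};q)_\infty}{2\pi\sqrt{1-x^2}}$, $x=\cos\theta$. For $a>0$ and a parameter $c$, $$(\mathcal{K}_{a,c}f)(\cos\theta)=q^{a(a-3)/4}\Big(\frac{1-q}{2c}\Big)^a h(\cos\theta;-cq^{1-a/2},-q^{a/2}/c)\int_0^\pi\frac{w_H(\cos\phi|q)\,(q^a;q)_\infty\, f(\cos\phi)\sin\phi\,d\phi}{h(\cos\phi;q^{a/2}e^{i\theta},q^{a/2}e^{-i\theta})\,h(\cos\phi;-1/c,-cq)} .$$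
   Formalization: In the logarithm the exponent (n+1)a/2-3/4 is corrected to (n+a)/2-3/4, the a-derivative of a(a-3)/4+na/2; the printed formula fails e.g. for n=1, a=2, c=1, q=1/2, θ=0, and the two agree when n=0 or a=1. *)

theory Defs
  imports "HOL-Analysis.Analysis"
begin

definition qpoch :: "real \<Rightarrow> complex \<Rightarrow> complex" where
  "qpoch q A = (\<Prod>k. 1 - A * of_real (q ^ k))"

definition qpochs :: "real \<Rightarrow> complex list \<Rightarrow> complex" where
  "qpochs q As = (\<Prod>A\<leftarrow>As. qpoch q A)"

text \<open>Functions of \<open>x = cos \<theta>\<close> are functions of the real variable \<open>x\<close>, with
  \<open>\<theta> = arccos x\<close> in \<open>[0, \<pi>]\<close> for \<open>x\<close> in \<open>[-1, 1]\<close>. All expressions below are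
  invariant under \<open>\<theta> \<mapsto> -\<theta>\<close>, so the choice of \<open>\<theta>\<close> is immaterial.\<close>

definition h :: "real \<Rightarrow> real \<Rightarrow> complex list \<Rightarrow> complex" where
  "h q x as = (let \<theta> = arccos x in
     (\<Prod>a\<leftarrow>as. qpochs q [a * exp (\<i> * of_real \<theta>), a * exp (- \<i> * of_real \<theta>)]))"

fun qHermite :: "real \<Rightarrow> nat \<Rightarrow> real \<Rightarrow> real" where
  "qHermite q 0 x = 1"
| "qHermite q (Suc 0) x = 2 * x"
| "qHermite q (Suc (Suc n)) x = 2 * x * qHermite q (Suc n) x - (1 - q ^ Suc n) * qHermite q n x"

definition wH :: "real \<Rightarrow> real \<Rightarrow> complex" where
  "wH q x = (let \<theta> = arccos x in
     qpochs q [of_real q, exp (2 * \<i> * of_real \<theta>), exp (- 2 * \<i> * of_real \<theta>)]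
       / of_real (2 * pi * sqrt (1 - x\<^sup>2)))"

text \<open>The parameter \<open>c\<close> is complex; the power \<open>((1-q)/(2c))\<^sup>a\<close> is the principal one.\<close>

definition K :: "real \<Rightarrow> real \<Rightarrow> complex \<Rightarrow> (real \<Rightarrow> complex) \<Rightarrow> real \<Rightarrow> complex" where
  "K q a c f x = (let \<theta> = arccos x in
     of_real (q powr (a * (a - 3) / 4)) * (of_real (1 - q) / (2 * c)) powr (of_real a)
     * h q x [- c * of_real (q powr (1 - a / 2)), - of_real (q powr (a / 2)) / c]
     * integral {0..pi} (\<lambda>\<phi>.
         wH q (cos \<phi>) * qpoch q (of_real (q powr a)) * f (cos \<phi>) * of_real (sin \<phi>)
         / (h q (cos \<phi>) [of_real (q powr (a / 2)) * exp (\<i> * of_real \<theta>),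
                          of_real (q powr (a / 2)) * exp (- \<i> * of_real \<theta>)]
            * h q (cos \<phi>) [- 1 / c, - c * of_real q])))"

text \<open>The limit of the difference quotients of operators is taken pointwise.\<close>

definition Jquot :: "real \<Rightarrow> real \<Rightarrow> complex \<Rightarrow> (real \<Rightarrow> complex) \<Rightarrow> real \<Rightarrow> real \<Rightarrow> complex" where
  "Jquot q a c f x d = (K q (a + d) c f x - K q a c f x) / of_real d"

definition J :: "real \<Rightarrow> real \<Rightarrow> complex \<Rightarrow> (real \<Rightarrow> complex) \<Rightarrow> real \<Rightarrow> complex" where
  "J q a c f x = Lim (at_right 0) (Jquot q a c f x)"

text \<open>The bilateral series \<open>\<Sum>\<^sub>k q\<^bsup>k(k-1)/2\<^esup> u\<^sup>k / (q;q)\<^sub>\<infinity> \<cdot> (k log q)/2\<close> over all integers \<open>k\<close>.\<close>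

definition logTheta :: "real \<Rightarrow> complex \<Rightarrow> complex" where
  "logTheta q u = (\<Sum>\<^sub>\<infinity>k\<in>(UNIV :: int set).
     of_real (q powi (k * (k - 1) div 2)) * u powi k / qpoch q (of_real q)
     * of_real (of_int k * ln q / 2))"

end

theory Submission
  imports Defs
begin

text \<open>The polynomials \<open>H\<^sub>n\<close> are eigenfunctions: the kernel of \<open>K\<close> is, up to the factors \<open>h\<close>, the Poisson
  kernel \<open>\<Sum> t\<^sup>m H\<^sub>m(x) H\<^sub>m(y) / (q;q)\<^sub>m\<close> at \<open>t = q\<^bsup>a/2\<^esup>\<close>, so by orthogonality the integral is
  \<open>q\<^bsup>na/2\<^esup> H\<^sub>n(cos \<theta>)\<close>. What remains is an elementary function of \<open>a\<close> times two theta functions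
  \<open>(-u, -q/u; q)\<^sub>\<infinity>\<close> with \<open>u\<close> proportional to \<open>q\<^bsup>a/2\<^esup>\<close>; expanding them by the Jacobi triple product and
  differentiating termwise in \<open>a\<close> gives the bilateral series.

  The finite triple product (the \<open>q\<close>-binomial theorem recentred) is used twice: its limit is the Jacobi
  triple product, and its vanishing at \<open>u = -1\<close> is the orthogonality of \<open>H\<^sub>n\<close> to constants. The
  Poisson kernel comes from a functional equation relating its values at \<open>t\<close> and \<open>q t\<close>.\<close>

subsection \<open>Preliminaries\<close>

lemma prod_lessThan_add:
  fixes f :: "nat \<Rightarrow> 'b :: comm_monoid_mult"
  shows "(\<Prod>i<m + n. f i) = (\<Prod>i<m. f i) * (\<Prod>i<n. f (m + i))"
  by (induction n) (simp_all add: mult.assoc)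

text \<open>Folds a sum of 2N + 1 terms about its middle index, so that a q-binomial sum can be read
  as a bilateral one.\<close>

lemma sum_atMost_centered:
  fixes f :: "nat \<Rightarrow> 'b :: comm_monoid_add"
  shows "(\<Sum>j\<le>2 * N. f j) = (\<Sum>k\<le>N. f (N - k)) + (\<Sum>k<N. f (N + Suc k))"
proof -
  have "(\<Sum>k\<le>N. f (N - k)) = (\<Sum>j\<le>N. f j)"
    using sum.nat_diff_reindex[of f "Suc N"] by (simp add: lessThan_Suc_atMost)
  moreover have "(\<Sum>j\<le>N + M. f j) = (\<Sum>j\<le>N. f j) + (\<Sum>k<M. f (N + Suc k))" for M
    by (induction M) (simp_all add: add.assoc)
  ultimately show ?thesis by (simp add: mult_2)
qed

lemma choose_two_Suc: "Suc n choose 2 = (n choose 2) + n"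
  by (simp add: numeral_2_eq_2)

text \<open>Subtraction-free form of the exponent of q that the term of index \<open>N - k\<close>
  collects in the q-binomial sum at u / q^N.\<close>

lemma choose_two_diff:
  "k \<le> N \<Longrightarrow> ((N - k) choose 2) + (Suc N choose 2) = (Suc k choose 2) + N * (N - k)"
proof (induction "N - k" arbitrary: k)
  case (Suc m)
  then have "m = N - Suc k" "Suc k \<le> N" by auto
  with Suc have IH: "(m choose 2) + (Suc N choose 2) = (Suc (Suc k) choose 2) + N * m" by metis
  have "N = Suc m + k" using Suc by simp
  then show ?case
    using IH Suc(2)[symmetric] by (simp add: choose_two_Suc algebra_simps)
qed simp

text \<open>The companion for indices above N. The constant \<open>Suc N choose 2\<close> is the
  same, so it becomes a common factor of both halves.\<close>

lemma choose_two_add: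
  "((N + Suc k) choose 2) + (Suc N choose 2) = (Suc k choose 2) + N * (N + Suc k)"
proof (induction k)
  case 0
  have "2 * (Suc N choose 2) = N * Suc N"
  proof (induction N)
    case (Suc N)
    then show ?case by (subst choose_two_Suc) simp
  qed (simp add: numeral_2_eq_2)
  then show ?case by (simp add: numeral_2_eq_2)
qed (simp add: choose_two_Suc algebra_simps)

text \<open>Uniform convergence carries continuity and the integral over to the limit. This serves
  both the cosine series of the weight and the Poisson series.\<close>

lemma Weierstrass_m_test_integral:
  fixes g :: "nat \<Rightarrow> real \<Rightarrow> 'b :: banach"
  assumes cont: "\<And>k. continuous_on {a..b} (g k)"
    and bound: "\<And>k x. x \<in> {a..b} \<Longrightarrow> norm (g k x) \<le> M k"
    and M: "summable M"
  shows "continuous_on {a..b} (\<lambda>x. \<Sum>k. g k x)"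
    and "(\<lambda>k. integral {a..b} (g k)) sums integral {a..b} (\<lambda>x. \<Sum>k. g k x)"
proof -
  have lim: "uniform_limit {a..b} (\<lambda>n x. \<Sum>k<n. g k x) (\<lambda>x. \<Sum>k. g k x) sequentially"
    using bound M by (rule Weierstrass_m_test)
  have cont': "continuous_on {a..b} (\<lambda>x. \<Sum>k<n. g k x)" for n
    by (intro continuous_intros cont)
  show "continuous_on {a..b} (\<lambda>x. \<Sum>k. g k x)"
    by (rule uniform_limit_theorem[OF _ lim]) (auto intro: cont' always_eventually)
  obtain I J where I: "\<And>n. ((\<lambda>x. \<Sum>k<n. g k x) has_integral I n) {a..b}"
    and J: "((\<lambda>x. \<Sum>k. g k x) has_integral J) {a..b}" and IJ: "I \<longlonglongrightarrow> J"
    using uniform_limit_integral[OF lim cont'] by auto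
  have "I n = (\<Sum>k<n. integral {a..b} (g k))" for n
    by (rule has_integral_unique[OF I])
      (intro has_integral_sum integrable_integral integrable_continuous_interval cont finite_lessThan)
  then have "I = (\<lambda>n. \<Sum>k<n. integral {a..b} (g k))"
    by (rule ext)
  with IJ show "(\<lambda>k. integral {a..b} (g k)) sums integral {a..b} (\<lambda>x. \<Sum>k. g k x)"
    by (simp only: sums_def integral_unique[OF J])
qed

section \<open>Cosine integrals\<close>

lemma has_integral_cos_int:
  "((\<lambda>x. cos (of_int m * x)) has_integral pi * of_bool (m = 0)) {0..pi}"
proof (cases "m = 0")
  case True
  then show ?thesis using has_integral_const_real[of "1 :: real" 0 pi] by simp
next
  case False
  have "((\<lambda>x. cos (of_int m * x)) has_integral sin (of_int m * pi) / of_int m - sin (of_int m * 0) / of_int m) {0..pi}"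
    using False by (intro fundamental_theorem_of_calculus)
      (auto intro!: derivative_eq_intros simp flip: has_real_derivative_iff_has_vector_derivative)
  moreover have "sin (of_int m * pi) = 0"
    by (simp add: sin_integer_2pi sin_zero_iff_int2)
  ultimately show ?thesis using False by simp
qed

text \<open>Product-to-sum formula. Both indicators fire when k = m = 0, which accounts for the
  value \<open>pi\<close> there.\<close>

lemma has_integral_cos_mult_cos:
  "((\<lambda>x. cos (of_int k * x) * cos (of_int m * x)) has_integral
     pi / 2 * (of_bool (k + m = 0) + of_bool (k = m))) {0..pi}"
proof -
  have "((\<lambda>x. (cos (of_int (k + m) * x) + cos (of_int (k - m) * x)) * (1 / 2)) has_integral
     (pi * of_bool (k + m = 0) + pi * of_bool (k - m = 0)) * (1 / 2)) {0..pi}"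
    by (intro has_integral_mult_left has_integral_add has_integral_cos_int)
  moreover have "(cos (of_int (k + m) * x) + cos (of_int (k - m) * x)) * (1 / 2) =
      cos (of_int k * x) * cos (of_int m * x)" for x :: real
    by (simp add: cos_times_cos algebra_simps)
  ultimately show ?thesis by (simp add: algebra_simps)
qed

lemma sums_power_shift:
  fixes f :: "nat \<Rightarrow> 'a :: real_normed_field"
  assumes "(\<lambda>n. f n * t ^ n) sums S"
  shows "(\<lambda>n. (if n < k then 0 else f (n - k)) * t ^ n) sums (t ^ k * S)"
proof -
  let ?g = "\<lambda>n. (if n < k then 0 else f (n - k)) * t ^ n"
  have "(\<lambda>n. ?g (n + k)) sums (t ^ k * S)"
    using sums_mult[OF assms, of "t ^ k"] by (simp add: power_add mult_ac)
  then show ?thesis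
    by (subst (asm) sums_iff_shift) simp
qed

lemma negligible_countable:
  fixes S :: "'a :: euclidean_space set"
  assumes "countable S"
  shows "negligible S"
proof -
  have "negligible (\<Union>x\<in>S. {x})"
    using assms by (intro negligible_countable_Union) auto
  then show ?thesis by simp
qed

section \<open>Evaluating \<open>h\<close> at the cosine of an angle\<close>

lemma h_cos_arccos:
  assumes "0 \<le> \<phi>" "\<phi> \<le> pi"
  shows "h q (cos \<phi>) [A, B] = qpoch q (A * cis \<phi>) * qpoch q (A * cis (- \<phi>)) *
    (qpoch q (B * cis \<phi>) * qpoch q (B * cis (- \<phi>)))"
  using assms by (simp add: h_def qpochs_def Let_def arccos_cos cis_conv_exp)

lemma cis_arccos_cos: "cis (arccos (cos \<theta>)) = cis \<theta> \<or> cis (arccos (cos \<theta>)) = cis (- \<theta>)"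
proof -
  have "sin (arccos (cos \<theta>)) = \<bar>sin \<theta>\<bar>"
    by (simp add: sin_arccos sin_squared_eq[symmetric])
  then show ?thesis
    by (auto simp: complex_eq_iff)
qed

text \<open>\<open>arccos (cos \<theta>)\<close> recovers the angle only up to sign and full turns.
  Exchanging \<open>cis \<theta>\<close> and \<open>cis (- \<theta>)\<close> merely permutes the
  factors, so every real angle is allowed.\<close>

lemma h_cos:
  "h q (cos \<theta>) [A, B] = qpoch q (A * cis \<theta>) * qpoch q (A * cis (- \<theta>)) *
    (qpoch q (B * cis \<theta>) * qpoch q (B * cis (- \<theta>)))"
proof -
  let ?t = "arccos (cos \<theta>)"
  have "h q (cos \<theta>) [A, B] = qpoch q (A * cis ?t) * qpoch q (A * cis (- ?t)) *
    (qpoch q (B * cis ?t) * qpoch q (B * cis (- ?t)))"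
    using h_cos_arccos[of ?t q A B] by (simp add: arccos_lbound arccos_ubound)
  moreover from cis_arccos_cos[of \<theta>]
  have "cis ?t = cis \<theta> \<and> cis (- ?t) = cis (- \<theta>) \<or> cis ?t = cis (- \<theta>) \<and> cis (- ?t) = cis \<theta>"
    by (auto simp: complex_eq_iff)
  ultimately show ?thesis
    by (auto simp: mult_ac)
qed

subsection \<open>The \<open>q\<close>-binomial theorem\<close>

locale qseries =
  fixes q :: real
  assumes q_gt0: "0 < q" and q_lt1: "q < 1"
begin

text \<open>The q-shifted factorial (q;q)_n.\<close>

definition qfac :: "nat \<Rightarrow> real" where
  "qfac n = (\<Prod>i<n. 1 - q ^ Suc i)"

text \<open>The Gaussian binomial coefficient. Its extension by zero lets sums run past n and keeps
  the recurrences free of side conditions.\<close>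

definition qbinom :: "nat \<Rightarrow> nat \<Rightarrow> real" where
  "qbinom n k = (if k \<le> n then qfac n / (qfac k * qfac (n - k)) else 0)"

lemma q_power_less_1: "q ^ Suc n < 1"
  by (rule power_Suc_less_one[OF q_gt0 q_lt1])

lemma q_power_Suc_neq_1 [simp]: "q * q ^ n \<noteq> 1"
  using q_power_less_1[of n] by simp

lemma qfac_0 [simp]: "qfac 0 = 1"
  by (simp add: qfac_def)

lemma qfac_Suc: "qfac (Suc n) = (1 - q ^ Suc n) * qfac n"
  by (simp add: qfac_def)

lemma qfac_pos: "qfac n > 0"
  unfolding qfac_def using q_power_less_1 by (intro prod_pos) (simp del: power_Suc)

lemma qfac_nonzero [simp]: "qfac n \<noteq> 0"
  using qfac_pos[of n] by simp

lemma qfac_le_1: "qfac n \<le> 1"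
  unfolding qfac_def
  by (rule prod_le_1) (use q_power_less_1 q_gt0 in \<open>simp add: less_imp_le del: power_Suc\<close>)

lemma qbinom_0 [simp]: "qbinom n 0 = 1"
  by (simp add: qbinom_def)

lemma qbinom_self [simp]: "qbinom n n = 1"
  by (simp add: qbinom_def)

lemma qbinom_eq_0 [simp]: "n < k \<Longrightarrow> qbinom n k = 0"
  by (simp add: qbinom_def)

lemma qbinom_symmetric: "k \<le> n \<Longrightarrow> qbinom n (n - k) = qbinom n k"
  by (simp add: qbinom_def)

lemma qbinom_nonneg: "0 \<le> qbinom n k"
  by (simp add: qbinom_def qfac_pos less_imp_le)

text \<open>The q-Pascal rule. For k > n the truncated exponent \<open>n - k\<close> is harmless
  because its coefficient is zero.\<close>

lemma qbinom_Suc_Suc: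
  "qbinom (Suc n) (Suc k) = q ^ (n - k) * qbinom n k + qbinom n (Suc k)"
proof (cases n k rule: linorder_cases)
  case greater
  define m where "m = n - Suc k"
  have n: "n = Suc (k + m)"
    using greater by (simp add: m_def)
  show ?thesis
    unfolding n qbinom_def
    by (simp add: Suc_diff_le qfac_Suc divide_simps power_add) (simp add: algebra_simps)
qed auto

lemma qbinom_absorb:
  "(1 - q ^ (Suc n - k)) * qbinom (Suc n) k = (1 - q ^ Suc n) * qbinom n k"
proof (cases "k \<le> n")
  case True
  then obtain m where n: "n = k + m"
    using le_Suc_ex by blast
  show ?thesis
    unfolding n qbinom_def
    by (simp add: Suc_diff_le qfac_Suc divide_simps power_add)
next
  case False
  then show ?thesis by (cases "k = Suc n") auto
qed

text \<open>Absorption rewrites the power of q in the q-Pascal rule. The result is the recurrence of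
  the \<open>H_n\<close> read off on Fourier coefficients.\<close>

lemma qbinom_Suc_Suc_three_term:
  "qbinom (Suc (Suc n)) (Suc k) =
    qbinom (Suc n) (Suc k) + qbinom (Suc n) k - (1 - q ^ Suc n) * qbinom n k"
  using qbinom_absorb[of n k] by (simp only: qbinom_Suc_Suc[of "Suc n"] algebra_simps)

text \<open>Both sides obey the same three-term recurrence, since multiplication by
  \<open>2 * cos \<phi>\<close> shifts each frequency by +1 and -1.\<close>

theorem qHermite_cos:
  "qHermite q n (cos \<phi>) = (\<Sum>j\<le>n. qbinom n j * cos ((real n - 2 * real j) * \<phi>))"
proof (induction n rule: induct_nat_012)
  case 1
  have "qbinom (Suc 0) (Suc 0) = 1" by (rule qbinom_self)
  then show ?case by simp
next
  case (ge2 n)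
  let ?C = "\<lambda>m. cos (m * \<phi>)"
  have two_cos: "2 * cos \<phi> * ?C m = ?C (m + 1) + ?C (m - 1)" for m
    by (simp add: algebra_simps cos_add cos_diff)
  \<comment> \<open>The added term j = n + 1 vanishes; it gives all sums the same range.\<close>
  have H0: "qHermite q n (cos \<phi>) = (\<Sum>j\<le>Suc n. qbinom n j * ?C (real n - 2 * real j))"
    using ge2(1) by simp
  have H1: "2 * cos \<phi> * qHermite q (Suc n) (cos \<phi>) =
      (\<Sum>j\<le>Suc n. qbinom (Suc n) j * ?C (real n + 2 - 2 * real j))
      + (\<Sum>j\<le>Suc n. qbinom (Suc n) j * ?C (real n - 2 * real j))"
    unfolding ge2(2) sum_distrib_left sum.distrib[symmetric]
  proof (rule sum.cong)
    fix j
    show "2 * cos \<phi> * (qbinom (Suc n) j * cos ((real (Suc n) - 2 * real j) * \<phi>)) =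
      qbinom (Suc n) j * ?C (real n + 2 - 2 * real j) + qbinom (Suc n) j * ?C (real n - 2 * real j)"
      using two_cos[of "real (Suc n) - 2 * real j"]
      by (simp add: algebra_simps)
  qed simp
  \<comment> \<open>Adding a vanishing top term and shifting j by one aligns the frequencies with n
    - 2j.\<close>
  have "(\<Sum>j\<le>Suc n. qbinom (Suc n) j * ?C (real n + 2 - 2 * real j))
      = (\<Sum>j\<le>Suc (Suc n). qbinom (Suc n) j * ?C (real n + 2 - 2 * real j))"
    by simp
  also have "\<dots> = ?C (real n + 2) + (\<Sum>j\<le>Suc n. qbinom (Suc n) (Suc j) * ?C (real n - 2 * real j))"
    by (subst sum.atMost_Suc_shift) (simp add: algebra_simps)
  finally have H2: "(\<Sum>j\<le>Suc n. qbinom (Suc n) j * ?C (real n + 2 - 2 * real j)) = \<dots>" .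
  have "(\<Sum>j\<le>Suc (Suc n). qbinom (Suc (Suc n)) j * ?C (real (Suc (Suc n)) - 2 * real j))
      = ?C (real n + 2) + (\<Sum>j\<le>Suc n. qbinom (Suc (Suc n)) (Suc j) * ?C (real n - 2 * real j))"
    by (subst sum.atMost_Suc_shift) (simp add: algebra_simps)
  also have "\<dots> = ?C (real n + 2) + (\<Sum>j\<le>Suc n. qbinom (Suc n) (Suc j) * ?C (real n - 2 * real j)
      + qbinom (Suc n) j * ?C (real n - 2 * real j)
      - (1 - q ^ Suc n) * (qbinom n j * ?C (real n - 2 * real j)))"
    by (simp only: qbinom_Suc_Suc_three_term algebra_simps)
  also have "\<dots> = 2 * cos \<phi> * qHermite q (Suc n) (cos \<phi>) - (1 - q ^ Suc n) * qHermite q n (cos \<phi>)"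
    unfolding H0 H1 H2 sum.distrib sum_subtractf sum_distrib_left[symmetric] by simp
  finally show ?case by simp
qed auto

text \<open>Multiplying by the new factor 1 + x q^n reproduces the q-Pascal rule coefficient by
  coefficient.\<close>

theorem qbinomial_theorem:
  fixes x :: "'a :: real_normed_field"
  shows "(\<Prod>i<n. 1 + x * of_real (q ^ i)) = (\<Sum>j\<le>n. of_real (qbinom n j * q ^ (j choose 2)) * x ^ j)"
proof (induction n)
  case (Suc n)
  let ?c = "\<lambda>n j. of_real (qbinom n j * q ^ (j choose 2)) * x ^ j"
  have step: "?c (Suc n) (Suc j) = ?c n (Suc j) + x * of_real (q ^ n) * ?c n j" if "j \<le> n" for j
  proof -
    have "q ^ n = q ^ (n - j) * q ^ j"
      using that by (simp flip: power_add)
    moreover have "Suc j choose 2 = (j choose 2) + j"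
      by (simp add: numeral_2_eq_2)
    ultimately show ?thesis
      by (simp add: qbinom_Suc_Suc power_add algebra_simps)
  qed
  have "(\<Sum>j\<le>Suc n. ?c (Suc n) j) = 1 + (\<Sum>j\<le>n. ?c (Suc n) (Suc j))"
    by (subst sum.atMost_Suc_shift) (simp add: numeral_2_eq_2)
  also have "\<dots> = 1 + (\<Sum>j\<le>n. ?c n (Suc j)) + x * of_real (q ^ n) * (\<Sum>j\<le>n. ?c n j)"
    using step by (simp add: sum.distrib sum_distrib_left)
  also have "1 + (\<Sum>j\<le>n. ?c n (Suc j)) = (\<Sum>j\<le>Suc n. ?c n j)"
    by (subst sum.atMost_Suc_shift) (simp add: numeral_2_eq_2)
  finally show ?case
    using Suc by (simp add: algebra_simps)
qed (simp add: numeral_2_eq_2)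


subsection \<open>The Jacobi triple product\<close>

lemma summable_q_power: "summable (\<lambda>k. norm (A * of_real (q ^ k) :: 'a :: real_normed_field))"
  using q_gt0 q_lt1 by (simp add: norm_mult norm_power summable_geometric summable_mult)

lemma convergent_prod_qpoch:
  "convergent_prod (\<lambda>k. 1 - A * of_real (q ^ k) :: 'a :: {real_normed_field, banach})"
proof -
  have "abs_convergent_prod (\<lambda>k. 1 - A * of_real (q ^ k) :: 'a)"
    using summable_q_power[of A] by (subst abs_convergent_prod_conv_summable) simp
  then show ?thesis by (rule abs_convergent_prod_imp_convergent_prod)
qed

lemma qpoch_LIMSEQ: "(\<lambda>n. \<Prod>i<n. 1 - A * of_real (q ^ i)) \<longlonglongrightarrow> qpoch q A"
  using convergent_prod_LIMSEQ[OF convergent_prod_qpoch[of A]]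
  by (subst filterlim_sequentially_Suc[symmetric]) (simp add: lessThan_Suc_atMost qpoch_def)

lemma qpoch_eq_0D: "qpoch q A = 0 \<Longrightarrow> \<exists>k. A * of_real (q ^ k) = 1"
  unfolding qpoch_def using prodinf_nonzero[OF convergent_prod_qpoch[of A]] by (metis eq_iff_diff_eq_0)

text \<open>The value (q;q)_\<infinity> as a real number, so that it can enter inequalities;
  \<open>qpoch_q\<close> links it to the complex product.\<close>

definition qfac_inf :: real where
  "qfac_inf = (\<Prod>i. 1 - q * q ^ i)"

lemma qfac_LIMSEQ: "qfac \<longlonglongrightarrow> qfac_inf"
  using convergent_prod_LIMSEQ[OF convergent_prod_qpoch[of q]]
  by (subst filterlim_sequentially_Suc[symmetric])
    (simp add: lessThan_Suc_atMost qfac_def[abs_def] qfac_inf_def)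

lemma qfac_inf_le_qfac: "qfac_inf \<le> qfac n"
proof (rule decseq_ge[OF _ qfac_LIMSEQ])
  show "decseq qfac"
    using q_gt0 qfac_pos less_imp_le
    by (intro decseq_SucI) (simp add: qfac_Suc mult_left_le_one_le power_le_one)
qed

lemma qfac_inf_pos: "qfac_inf > 0"
proof -
  have "qfac_inf \<noteq> 0"
    unfolding qfac_inf_def
    using prodinf_nonzero[OF convergent_prod_qpoch[of q]] q_power_Suc_neq_1 by simp
  moreover have "qfac_inf \<ge> 0"
    by (rule LIMSEQ_le_const[OF qfac_LIMSEQ]) (use qfac_pos less_imp_le in blast)
  ultimately show ?thesis by simp
qed

lemma qpoch_q: "qpoch q (of_real q) = of_real qfac_inf"
proof (rule LIMSEQ_unique[OF qpoch_LIMSEQ])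
  show "(\<lambda>n. \<Prod>i<n. 1 - of_real q * of_real (q ^ i)) \<longlonglongrightarrow> (of_real qfac_inf :: complex)"
    using tendsto_of_real[OF qfac_LIMSEQ, where ?'a = complex] by (simp add: qfac_def)
qed

text \<open>The numerator is at most 1 and each denominator factor at least (q;q)_\<infinity>.
  Uniformity in n and k provides the majorants used later.\<close>

lemma qbinom_le: "qbinom n k \<le> 1 / qfac_inf\<^sup>2"
proof -
  have "qfac n / (qfac k * qfac (n - k)) \<le> 1 / (qfac_inf * qfac_inf)"
    using qfac_inf_pos qfac_inf_le_qfac qfac_le_1
    by (intro frac_le mult_mono) (auto intro: less_imp_le qfac_pos)
  then show ?thesis
    using qfac_inf_pos by (simp add: qbinom_def power2_eq_square)
qed

text \<open>All three factorials tend to (q;q)_\<infinity>, and two of them stand in the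
  denominator.\<close>

lemma qbinom_central_LIMSEQ: "(\<lambda>N. qbinom (2 * N) (N + k)) \<longlonglongrightarrow> 1 / qfac_inf"
proof -
  have "(\<lambda>N. qfac (2 * N) / (qfac (N + k) * qfac (N - k))) \<longlonglongrightarrow> qfac_inf / (qfac_inf * qfac_inf)"
  proof (intro tendsto_intros)
    show "(\<lambda>N. qfac (2 * N)) \<longlonglongrightarrow> qfac_inf"
      by (rule filterlim_compose[OF qfac_LIMSEQ mult_nat_left_at_top]) simp
    show "(\<lambda>N. qfac (N + k)) \<longlonglongrightarrow> qfac_inf"
      by (rule LIMSEQ_ignore_initial_segment[OF qfac_LIMSEQ])
    show "(\<lambda>N. qfac (N - k)) \<longlonglongrightarrow> qfac_inf"
      by (rule filterlim_compose[OF qfac_LIMSEQ filterlim_minus_const_nat_at_top])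
  qed (use qfac_inf_pos in auto)
  moreover have "eventually (\<lambda>N. qfac (2 * N) / (qfac (N + k) * qfac (N - k)) = qbinom (2 * N) (N + k)) sequentially"
    using eventually_ge_at_top[of k] by eventually_elim (auto simp: qbinom_def mult_2)
  ultimately show ?thesis
    using qfac_inf_pos by (simp add: tendsto_cong)
qed

text \<open>This is the q-binomial theorem with 2N factors at x = u / q^N: the upper N factors are 1
  + u q^i, and the lower N become 1 + q^(i+1) / u once u / q^(i+1) is pulled out of each.\<close>

theorem finite_triple_product:
  fixes u :: "'a :: real_normed_field"
  assumes u: "u \<noteq> 0"
  shows "(\<Prod>i<N. (1 + u * of_real (q ^ i)) * (1 + of_real (q ^ Suc i) / u)) =
    (\<Sum>k\<le>N. of_real (q ^ (Suc k choose 2)) *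
      (of_real (qbinom (2 * N) (N + Suc k)) * u ^ Suc k + of_real (qbinom (2 * N) (N + k)) / u ^ k))"
    (is "?lhs = ?rhs")
proof -
  have q0: "of_real q \<noteq> (0 :: 'a)" using q_gt0 by simp
  let ?x = "u / of_real (q ^ N)"
  \<comment> \<open>The product of everything pulled out of the lower factors; it is cancelled at
    the end.\<close>
  let ?C = "u ^ N / of_real (q ^ (Suc N choose 2))"
  let ?f = "\<lambda>j. of_real (qbinom (2 * N) j * q ^ (j choose 2)) * ?x ^ j"
  have C0: "?C \<noteq> 0" using u q0 by simp
  \<comment> \<open>Turns the two exponent identities into quotients with the denominator of
    \<open>?C\<close>.\<close>
  have coeff: "of_real (q ^ i) / of_real (q ^ N) ^ j = (of_real (q ^ l) / of_real (q ^ (Suc N choose 2)) :: 'a)"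
    if "i + (Suc N choose 2) = l + N * j" for i j l
  proof -
    have "q ^ i * q ^ (Suc N choose 2) = q ^ l * (q ^ N) ^ j"
      by (simp only: power_add[symmetric] power_mult[symmetric] that)
    then have "of_real (q ^ i) * of_real (q ^ (Suc N choose 2)) = (of_real (q ^ l) * of_real (q ^ N) ^ j :: 'a)"
      by (simp only: of_real_mult[symmetric] of_real_power[symmetric])
    then show ?thesis
      using q0 by (subst frac_eq_eq) auto
  qed
  have prod_q: "(\<Prod>i<n. of_real (q ^ Suc i)) = (of_real (q ^ (Suc n choose 2)) :: 'a)" for n
    by (induction n) (simp_all add: choose_two_Suc power_add algebra_simps, simp add: numeral_2_eq_2)
  have "(\<Prod>i<N. 1 + ?x * of_real (q ^ i)) = (\<Prod>i<N. 1 + ?x * of_real (q ^ (N - Suc i)))"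
    by (rule prod.nat_diff_reindex[symmetric])
  also have "\<dots> = (\<Prod>i<N. u / of_real (q ^ Suc i) * (1 + of_real (q ^ Suc i) / u))"
  proof (rule prod.cong)
    fix i assume "i \<in> {..<N}"
    then have "q ^ N = q ^ Suc i * q ^ (N - Suc i)"
      by (simp flip: power_add power_Suc)
    then show "1 + ?x * of_real (q ^ (N - Suc i)) = u / of_real (q ^ Suc i) * (1 + of_real (q ^ Suc i) / u)"
      using u q0 by (simp add: field_simps)
  qed simp
  also have "\<dots> = ?C * (\<Prod>i<N. 1 + of_real (q ^ Suc i) / u)"
    by (simp only: prod.distrib prod_dividef prod_q prod_constant card_lessThan)
  finally have low: "(\<Prod>i<N. 1 + ?x * of_real (q ^ i)) = \<dots>" .
  have high: "(\<Prod>i<N. 1 + ?x * of_real (q ^ (N + i))) = (\<Prod>i<N. 1 + u * of_real (q ^ i))"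
    using q0 by (simp add: power_add)
  have "(\<Prod>i<2 * N. 1 + ?x * of_real (q ^ i)) = ?C * ?lhs"
    unfolding mult_2 prod_lessThan_add low high prod.distrib by (simp only: mult_ac)
  then have "?C * ?lhs = (\<Sum>j\<le>2 * N. ?f j)"
    by (simp only: qbinomial_theorem)
  also have "\<dots> = (\<Sum>k\<le>N. ?f (N - k)) + (\<Sum>k<N. ?f (N + Suc k))"
    by (rule sum_atMost_centered)
  \<comment> \<open>The new term k = N vanishes, its index 2N + 1 being above the diagonal; both
    halves now have one range.\<close>
  also have "(\<Sum>k<N. ?f (N + Suc k)) = (\<Sum>k\<le>N. ?f (N + Suc k))"
    by (simp flip: lessThan_Suc_atMost)
  also have "(\<Sum>k\<le>N. ?f (N + Suc k)) =
      (\<Sum>k\<le>N. ?C * (of_real (q ^ (Suc k choose 2)) * (of_real (qbinom (2 * N) (N + Suc k)) * u ^ Suc k)))"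
  proof (rule sum.cong)
    fix k
    have "?f (N + Suc k) = of_real (qbinom (2 * N) (N + Suc k))
        * (of_real (q ^ ((N + Suc k) choose 2)) / of_real (q ^ N) ^ (N + Suc k)) * (u ^ N * u ^ Suc k)"
      by (simp only: of_real_mult power_divide power_add[of u] times_divide_eq_left times_divide_eq_right mult_ac)
    then show "?f (N + Suc k) = ?C * (of_real (q ^ (Suc k choose 2)) *
        (of_real (qbinom (2 * N) (N + Suc k)) * u ^ Suc k))"
      unfolding coeff[OF choose_two_add] by (simp only: times_divide_eq_left times_divide_eq_right mult_ac)
  qed simp
  also have "(\<Sum>k\<le>N. ?f (N - k)) =
      (\<Sum>k\<le>N. ?C * (of_real (q ^ (Suc k choose 2)) * (of_real (qbinom (2 * N) (N + k)) / u ^ k)))"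
  proof (rule sum.cong)
    fix k assume "k \<in> {..N}"
    then have k: "k \<le> N" by simp
    have b: "qbinom (2 * N) (N - k) = qbinom (2 * N) (N + k)"
      using qbinom_symmetric[of "N + k" "2 * N"] k by (simp add: mult_2)
    have "?f (N - k) = of_real (qbinom (2 * N) (N + k))
        * (of_real (q ^ ((N - k) choose 2)) / of_real (q ^ N) ^ (N - k)) * (u ^ N / u ^ k)"
      unfolding b power_diff[OF u k, symmetric]
      by (simp only: of_real_mult power_divide times_divide_eq_left times_divide_eq_right mult_ac)
    then show "?f (N - k) = ?C * (of_real (q ^ (Suc k choose 2)) * (of_real (qbinom (2 * N) (N + k)) / u ^ k))"
      unfolding coeff[OF choose_two_diff[OF k]]
      by (simp only: times_divide_eq_left times_divide_eq_right divide_divide_eq_left mult_ac)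
  qed simp
  also have "\<dots> + (\<Sum>k\<le>N. ?C * (of_real (q ^ (Suc k choose 2)) * (of_real (qbinom (2 * N) (N + Suc k)) * u ^ Suc k))) = ?C * ?rhs"
    by (simp only: sum_distrib_left sum.distrib[symmetric] distrib_left add.commute)
  finally show ?thesis by (rule mult_left_cancel[THEN iffD1, OF C0])
qed

text \<open>The ratio of consecutive terms is r q^(k+1), which tends to 0 whatever r is.\<close>

lemma summable_theta_real: "summable (\<lambda>k. q ^ (Suc k choose 2) * r ^ k)" if "r \<ge> 0" for r :: real
proof -
  have "(\<lambda>k. q * r * q ^ k) \<longlonglongrightarrow> q * r * 0"
    using q_gt0 q_lt1 by (intro tendsto_intros LIMSEQ_realpow_zero) auto
  then have "eventually (\<lambda>k. q * r * q ^ k < 1 / 2) sequentially"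
    using order_tendstoD(2)[of _ 0 _ "1 / 2 :: real"] by simp
  then obtain N where N: "\<And>k. k \<ge> N \<Longrightarrow> q * r * q ^ k < 1 / 2"
    by (auto simp: eventually_sequentially)
  show ?thesis
  proof (rule summable_ratio_test[of "1/2" N])
    fix k assume "N \<le> k"
    have "norm (q ^ (Suc (Suc k) choose 2) * r ^ Suc k) = (q * r * q ^ k) * norm (q ^ (Suc k choose 2) * r ^ k)"
      using that q_gt0 by (subst choose_two_Suc) (simp add: power_add abs_mult)
    also have "\<dots> \<le> 1 / 2 * norm (q ^ (Suc k choose 2) * r ^ k)"
      using N[OF \<open>N \<le> k\<close>] by (intro mult_right_mono) auto
    finally show "norm (q ^ (Suc (Suc k) choose 2) * r ^ Suc k) \<le> \<dots>" .
  qed simp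
qed

lemma summable_norm_theta:
  "summable (\<lambda>k. norm (of_real (q ^ (Suc k choose 2)) * v ^ k :: 'a :: real_normed_field))"
  using summable_theta_real[of "norm v"] q_gt0 by (simp add: norm_mult norm_power)

text \<open>The exponent \<open>k (k - 1) / 2\<close> is invariant under \<open>k \<mapsto> 1 - k\<close>; pairing these two terms folds the
  bilateral series into a series over the natural numbers.\<close>
theorem triple_product:
  assumes u: "u \<noteq> 0"
  shows "(\<lambda>k. of_real (q ^ (Suc k choose 2)) * (u ^ Suc k + 1 / u ^ k)) sums
    (of_real qfac_inf * qpoch q (- u) * qpoch q (- of_real q / u))"
proof -
  let ?t = "\<lambda>k. of_real (q ^ (Suc k choose 2)) :: complex"
  let ?a = "\<lambda>k N. ?t k * (of_real (qbinom (2 * N) (N + Suc k)) * u ^ Suc k + of_real (qbinom (2 * N) (N + k)) / u ^ k)"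
  let ?b = "\<lambda>k. ?t k * (of_real (1 / qfac_inf) * u ^ Suc k + of_real (1 / qfac_inf) / u ^ k)"
  let ?M = "\<lambda>k. q ^ (Suc k choose 2) * (1 / qfac_inf\<^sup>2 * norm u ^ Suc k + 1 / qfac_inf\<^sup>2 / norm u ^ k)"
  have "summable (\<lambda>k. norm u / qfac_inf\<^sup>2 * (q ^ (Suc k choose 2) * norm u ^ k)
      + 1 / qfac_inf\<^sup>2 * (q ^ (Suc k choose 2) * (1 / norm u) ^ k))"
    by (intro summable_add summable_mult summable_theta_real) auto
  then have M: "summable ?M"
    by (simp add: algebra_simps power_divide)
  have bound: "norm (?a k N) \<le> ?M k" for k N
  proof -
    have 1: "norm (of_real (qbinom m j) * (w :: complex)) \<le> 1 / qfac_inf\<^sup>2 * norm w" for m j w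
      using mult_right_mono[OF qbinom_le[of m j], of "norm w"] qbinom_nonneg[of m j] by (simp add: norm_mult)
    have "norm (of_real (qbinom (2 * N) (N + Suc k)) * u ^ Suc k + of_real (qbinom (2 * N) (N + k)) / u ^ k)
        \<le> 1 / qfac_inf\<^sup>2 * norm u ^ Suc k + 1 / qfac_inf\<^sup>2 / norm u ^ k"
      using 1[of "2 * N" "N + Suc k" "u ^ Suc k"] 1[of "2 * N" "N + k" "1 / u ^ k"]
      by (intro norm_triangle_le add_mono) (auto simp: norm_mult norm_divide norm_power)
    then show ?thesis
      using q_gt0 by (simp add: norm_mult norm_power mult_left_mono)
  qed
  have lim: "(\<lambda>N. ?a k N) \<longlonglongrightarrow> ?b k" for k
    using qbinom_central_LIMSEQ[of "Suc k"] qbinom_central_LIMSEQ[of k] u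
    by (intro tendsto_intros) auto
  have ev: "eventually (\<lambda>(k, N). norm (?a k N) \<le> ?M k) (at_top \<times>\<^sub>F sequentially)"
  proof (rule always_eventually, rule allI)
    fix p :: "nat \<times> nat"
    show "case p of (k, N) \<Rightarrow> norm (?a k N) \<le> ?M k"
      unfolding case_prod_beta by (rule bound)
  qed
  \<comment> \<open>Dominated convergence for series, as N tends to infinity in the finite triple
    product.\<close>
  note tan = tannerys_theorem[of ?a ?b sequentially ?M, OF lim ev M sequentially_bot]
  \<comment> \<open>For fixed N the terms with k > N vanish, so the series is the finite
    sum.\<close>
  have "suminf (\<lambda>k. ?a k N) = (\<Prod>i<N. (1 + u * of_real (q ^ i)) * (1 + of_real (q ^ Suc i) / u))" for N
    unfolding finite_triple_product[OF u] by (rule suminf_finite) auto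
  moreover have "(\<lambda>N. \<Prod>i<N. (1 + u * of_real (q ^ i)) * (1 + of_real (q ^ Suc i) / u))
      \<longlonglongrightarrow> qpoch q (- u) * qpoch q (- of_real q / u)"
    using tendsto_mult[OF qpoch_LIMSEQ[of "- u"] qpoch_LIMSEQ[of "- of_real q / u"]]
    by (simp add: prod.distrib)
  ultimately have "suminf ?b = qpoch q (- u) * qpoch q (- of_real q / u)"
    using LIMSEQ_unique[OF tan[THEN conjunct2, THEN conjunct2]] by simp
  moreover have "summable ?b"
    by (rule summable_norm_cancel[OF tan[THEN conjunct2, THEN conjunct1]])
  ultimately have "?b sums (qpoch q (- u) * qpoch q (- of_real q / u))"
    by (simp only: sums_iff)
  moreover have "of_real qfac_inf * ?b k = ?t k * (u ^ Suc k + 1 / u ^ k)" for k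
    using qfac_inf_pos by (simp add: distrib_left)
  ultimately show ?thesis
    using sums_mult[of ?b _ "of_real qfac_inf"] by (simp only: mult.assoc)
qed


subsection \<open>Orthogonality\<close>

lemma qpoch_Suc: "qpoch q A = (1 - A) * qpoch q (A * of_real q)"
proof -
  have "(\<lambda>n. \<Prod>i<Suc n. 1 - A * of_real (q ^ i)) \<longlonglongrightarrow> (1 - A) * qpoch q (A * of_real q)"
    using tendsto_mult[OF tendsto_const[of "1 - A"] qpoch_LIMSEQ[of "A * of_real q"]]
    by (simp add: prod.lessThan_Suc_shift mult.assoc del: prod.lessThan_Suc)
  then show ?thesis
    using LIMSEQ_unique LIMSEQ_Suc[OF qpoch_LIMSEQ[of A]] by blast
qed

definition weight_term :: "nat \<Rightarrow> real \<Rightarrow> real" where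
  "weight_term k \<phi> = (- 1) ^ k * q ^ (Suc k choose 2) * (2 * (cos (2 * real k * \<phi>) - cos (2 * real (Suc k) * \<phi>)))"

text \<open>The numerator of \<open>wH\<close> at \<open>cos \<phi>\<close>, namely (q,
  e^(2i\<phi>), e^(-2i\<phi>); q)_\<infinity>, given by its Fourier series so that it is visibly
  real and can be integrated termwise.\<close>

definition weight :: "real \<Rightarrow> real" where
  "weight \<phi> = (\<Sum>k. weight_term k \<phi>)"

text \<open>The triple product at u = -w with w = e^(2i\<phi>) gives (q, w, q/w; q)_\<infinity>. The
  missing factor 1 - 1/w completes q/w to 1/w and turns each folded pair into a difference of
  cosines.\<close>

theorem weight_eq_qpoch:
  "of_real (weight \<phi>) = of_real qfac_inf * qpoch q (cis (2 * \<phi>)) * qpoch q (cis (- 2 * \<phi>))"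
proof -
  define w where "w = cis (2 * \<phi>)"
  have w0: "w \<noteq> 0" and w1: "cis (- 2 * \<phi>) = 1 / w"
    by (simp_all add: w_def cis_inverse inverse_eq_divide[symmetric])
  have wk: "w ^ k + 1 / w ^ k = of_real (2 * cos (2 * real k * \<phi>))" for k
  proof -
    have "w ^ k = cis (2 * real k * \<phi>)"
      unfolding w_def Complex.DeMoivre by (rule arg_cong[where f = cis]) simp
    moreover have "1 / cis x = cis (- x)" for x
      by (simp add: divide_inverse cis_inverse)
    ultimately have "w ^ k + 1 / w ^ k = cis (2 * real k * \<phi>) + cis (- (2 * real k * \<phi>))"
      by (simp only:)
    then show ?thesis by (simp add: complex_eq_iff)
  qed
  have "(1 - 1 / w) * (of_real (q ^ (Suc k choose 2)) * ((- w) ^ Suc k + 1 / (- w) ^ k)) =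
      of_real (weight_term k \<phi>)" for k
  proof -
    have "(1 - 1 / w) * ((- w) ^ Suc k + 1 / (- w) ^ k) =
        (- 1) ^ k * ((w ^ k + 1 / w ^ k) - (w ^ Suc k + 1 / w ^ Suc k))"
      using w0 by (simp add: power_minus[of w] field_simps)
    then show ?thesis
      unfolding wk weight_term_def by (simp add: mult_ac)
  qed
  moreover have "(\<lambda>k. (1 - 1 / w) * (of_real (q ^ (Suc k choose 2)) * ((- w) ^ Suc k + 1 / (- w) ^ k)))
      sums ((1 - 1 / w) * (of_real qfac_inf * qpoch q w * qpoch q (of_real q / w)))"
    using sums_mult[OF triple_product[of "- w"], of "1 - 1 / w"] w0 by simp
  ultimately have "(\<lambda>k. of_real (weight_term k \<phi>)) sums ((1 - 1 / w) * (of_real qfac_inf * qpoch q w * qpoch q (of_real q / w)))"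
    by simp
  moreover have "qpoch q (1 / w) = (1 - 1 / w) * qpoch q (of_real q / w)"
    using qpoch_Suc[of "1 / w"] by simp
  ultimately have *: "(\<lambda>k. complex_of_real (weight_term k \<phi>)) sums (of_real qfac_inf * qpoch q w * qpoch q (1 / w))"
    by (simp add: mult_ac)
  then have "summable (\<lambda>k. weight_term k \<phi>)"
    by (simp add: sums_iff summable_of_real_iff)
  then have "of_real (weight \<phi>) = (\<Sum>k. complex_of_real (weight_term k \<phi>))"
    unfolding weight_def by (rule suminf_of_real)
  with * show ?thesis
    unfolding w1 w_def[symmetric] by (simp add: sums_iff)
qed

lemma weight_term_bound: "\<bar>weight_term k \<phi>\<bar> \<le> 4 * q ^ (Suc k choose 2)"
proof -
  have "\<bar>2 * (cos (2 * real k * \<phi>) - cos (2 * real (Suc k) * \<phi>))\<bar> \<le> 4"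
  proof -
    have "\<bar>2 * (x - y)\<bar> \<le> 4" if "\<bar>x\<bar> \<le> 1" "\<bar>y\<bar> \<le> 1" for x y :: real
      using that by (auto simp: abs_le_iff)
    then show ?thesis by (simp only: abs_cos_le_one)
  qed
  then show ?thesis
    unfolding weight_term_def abs_mult using q_gt0
    by (simp add: power_abs mult.commute mult_left_mono)
qed

lemma summable_weight_bound: "summable (\<lambda>k. 4 * q ^ (Suc k choose 2))"
  using summable_mult[OF summable_theta_real[of 1], of 4] by simp

lemma summable_weight_term: "summable (\<lambda>k. weight_term k \<phi>)"
  by (rule summable_comparison_test'[OF summable_weight_bound])
    (use weight_term_bound in simp)

lemma continuous_on_weight_term [continuous_intros]: "continuous_on S (weight_term k)"
  unfolding weight_term_def by (intro continuous_intros)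

lemma continuous_on_weight: "continuous_on {a..b} weight"
  unfolding weight_def using weight_term_bound
  by (intro Weierstrass_m_test_integral(1)[OF _ _ summable_weight_bound] continuous_intros) simp

section \<open>Integrals of the weight against the polynomials\<close>

lemma continuous_on_qHermite_cos: "continuous_on S (\<lambda>\<phi>. qHermite q n (cos \<phi>))"
  unfolding qHermite_cos by (intro continuous_intros)

text \<open>The Fourier expansion has n + 1 terms, each bounded by \<open>qbinom_le\<close>. Linear
  growth in n is good enough against powers of t.\<close>

lemma abs_qHermite_cos_le: "\<bar>qHermite q n (cos \<phi>)\<bar> \<le> real (Suc n) / qfac_inf\<^sup>2"
proof -
  have "\<bar>qHermite q n (cos \<phi>)\<bar> \<le> (\<Sum>j\<le>n. \<bar>qbinom n j * cos ((real n - 2 * real j) * \<phi>)\<bar>)"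
    unfolding qHermite_cos by (rule sum_abs)
  also have "\<dots> \<le> (\<Sum>j\<le>n. 1 / qfac_inf\<^sup>2)"
  proof (rule sum_mono)
    fix j
    show "\<bar>qbinom n j * cos ((real n - 2 * real j) * \<phi>)\<bar> \<le> 1 / qfac_inf\<^sup>2"
      using mult_mono[OF qbinom_le[of n j] abs_cos_le_one[of "(real n - 2 * real j) * \<phi>"]] qbinom_nonneg[of n j]
      by (simp add: abs_mult)
  qed
  finally show ?thesis by simp
qed

text \<open>Only the frequencies n - 2j = 2k and n - 2j = -2k survive. Their coefficients agree by
  symmetry of the Gaussian binomial, each contributing half; for odd n there are none.\<close>

lemma has_integral_cos_mult_qHermite:
  "((\<lambda>\<phi>. cos (2 * real k * \<phi>) * qHermite q n (cos \<phi>)) has_integral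
     (if even n then pi * qbinom n (n div 2 + k) else 0)) {0..pi}"
proof -
  let ?d = "\<lambda>j. of_bool (2 * int k + (int n - 2 * int j) = 0) + of_bool (2 * int k = int n - 2 * int j) :: real"
  have "((\<lambda>\<phi>. \<Sum>j\<le>n. qbinom n j * (cos (of_int (2 * int k) * \<phi>) * cos (of_int (int n - 2 * int j) * \<phi>)))
      has_integral (\<Sum>j\<le>n. qbinom n j * (pi / 2 * ?d j))) {0..pi}"
    by (intro has_integral_sum has_integral_mult_right has_integral_cos_mult_cos) simp
  moreover have "(\<Sum>j\<le>n. qbinom n j * (cos (of_int (2 * int k) * \<phi>) * cos (of_int (int n - 2 * int j) * \<phi>)))
      = cos (2 * real k * \<phi>) * qHermite q n (cos \<phi>)" for \<phi>
    by (simp add: qHermite_cos sum_distrib_left mult_ac)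
  moreover have "(\<Sum>j\<le>n. qbinom n j * (pi / 2 * ?d j)) = (if even n then pi * qbinom n (n div 2 + k) else 0)"
  proof (cases "even n")
    case False
    then have "?d j = 0" for j
      by (auto simp: of_bool_def) presburger+
    then show ?thesis using False by simp
  next
    case True
    then obtain s where n: "n = 2 * s" by blast
    have d: "?d j = of_bool (j = s + k) + of_bool (s = j + k)" for j
      by (auto simp: of_bool_def n)
    have 1: "(\<Sum>j\<le>n. qbinom n j * of_bool (j = s + k)) = qbinom n (s + k)"
      by (auto simp: of_bool_def if_distrib sum.delta cong: if_cong)
    have 2: "(\<Sum>j\<le>n. qbinom n j * of_bool (s = j + k)) = qbinom n (s + k)"
    proof (cases "k \<le> s")
      case True
      then have "(s = j + k) = (j = s - k)" for j by auto
      moreover have "qbinom n (s - k) = qbinom n (s + k)"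
        using qbinom_symmetric[of "s + k" n] True by (simp add: n)
      ultimately show ?thesis
        using True by (simp add: of_bool_def if_distrib sum.delta n cong: if_cong)
    qed (auto simp: of_bool_def n)
    have "(\<Sum>j\<le>n. qbinom n j * (pi / 2 * ?d j)) = pi / 2 *
        ((\<Sum>j\<le>n. qbinom n j * of_bool (j = s + k)) + (\<Sum>j\<le>n. qbinom n j * of_bool (s = j + k)))"
      unfolding d by (simp only: distrib_left sum.distrib sum_distrib_left mult.left_commute[of _ "pi / 2"])
    then show ?thesis
      unfolding 1 2 using n by simp
  qed
  ultimately show ?thesis by simp
qed

text \<open>Termwise integration turns the weight series into the finite triple product at u = -1,
  which contains the factor 1 + u = 0 unless it is empty.\<close>

theorem integral_weight_qHermite:
  "integral {0..pi} (\<lambda>\<phi>. weight \<phi> * qHermite q n (cos \<phi>)) = 2 * pi * of_bool (n = 0)"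
proof -
  let ?g = "\<lambda>k \<phi>. weight_term k \<phi> * qHermite q n (cos \<phi>)"
  have "norm (?g k \<phi>) \<le> 4 * q ^ (Suc k choose 2) * (real (Suc n) / qfac_inf\<^sup>2)" for k \<phi>
    unfolding real_norm_def abs_mult
    by (intro mult_mono weight_term_bound abs_qHermite_cos_le) (use q_gt0 in auto)
  then have "(\<lambda>k. integral {0..pi} (?g k)) sums integral {0..pi} (\<lambda>\<phi>. \<Sum>k. ?g k \<phi>)"
    by (intro Weierstrass_m_test_integral(2)[OF _ _ summable_mult2[OF summable_weight_bound]]
        continuous_intros continuous_on_qHermite_cos)
  moreover have "(\<Sum>k. ?g k \<phi>) = weight \<phi> * qHermite q n (cos \<phi>)" for \<phi>
    unfolding weight_def by (rule suminf_mult2[OF summable_weight_term, symmetric])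
  ultimately have sums: "(\<lambda>k. integral {0..pi} (?g k)) sums integral {0..pi} (\<lambda>\<phi>. weight \<phi> * qHermite q n (cos \<phi>))"
    by simp
  let ?c = "\<lambda>k. if even n then pi * qbinom n (n div 2 + k) else 0"
  have "(?g k has_integral ((- 1) ^ k * q ^ (Suc k choose 2) * 2) * (?c k - ?c (Suc k))) {0..pi}" for k
  proof -
    have "((\<lambda>\<phi>. ((- 1) ^ k * q ^ (Suc k choose 2) * 2) * (cos (2 * real k * \<phi>) * qHermite q n (cos \<phi>)
        - cos (2 * real (Suc k) * \<phi>) * qHermite q n (cos \<phi>)))
      has_integral ((- 1) ^ k * q ^ (Suc k choose 2) * 2) * (?c k - ?c (Suc k))) {0..pi}"
      by (intro has_integral_mult_right has_integral_diff has_integral_cos_mult_qHermite)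
    then show ?thesis
      by (simp add: weight_term_def algebra_simps)
  qed
  then have int: "integral {0..pi} (?g k) = ((- 1) ^ k * q ^ (Suc k choose 2) * 2) * (?c k - ?c (Suc k))" for k
    by (rule integral_unique)
  show ?thesis
  proof (cases "even n")
    case False
    then show ?thesis using sums sums_unique2[OF sums_zero] by (auto simp: int)
  next
    case True
    then obtain s where n: "n = 2 * s" by blast
    \<comment> \<open>The signs are distributed so as to match the powers of u = -1 in
      \<open>finite_triple_product\<close>.\<close>
    have "integral {0..pi} (?g k) = 2 * pi * (q ^ (Suc k choose 2) *
        (qbinom (2 * s) (s + Suc k) * (- 1) ^ Suc k + qbinom (2 * s) (s + k) / (- 1) ^ k))" for k
      unfolding int unfolding n by (cases "even k") (simp_all add: algebra_simps)
    then have "(\<lambda>k. 2 * pi * (q ^ (Suc k choose 2) *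
        (qbinom (2 * s) (s + Suc k) * (- 1) ^ Suc k + qbinom (2 * s) (s + k) / (- 1) ^ k)))
       sums integral {0..pi} (\<lambda>\<phi>. weight \<phi> * qHermite q n (cos \<phi>))" (is "?f sums ?I")
      using sums by simp
    moreover have "?f sums (\<Sum>k\<le>s. ?f k)"
      by (rule sums_finite) auto
    ultimately have "?I = (\<Sum>k\<le>s. ?f k)"
      by (rule sums_unique2)
    also have "\<dots> = 2 * pi * (\<Prod>i<s. (1 + (- 1) * q ^ i) * (1 + q ^ Suc i / (- 1)))"
      using finite_triple_product[of "- 1 :: real" s] by (simp add: sum_distrib_left)
    also have "\<dots> = 2 * pi * of_bool (n = 0)"
      by (cases s) (simp_all add: n prod.lessThan_Suc_shift del: prod.lessThan_Suc)
    finally show ?thesis .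
  qed
qed

text \<open>For \<open>n = 0\<close> the truncated index \<open>n - 1\<close> is harmless because its coefficient vanishes.\<close>
lemma qHermite_three_term:
  "2 * x * qHermite q n x = qHermite q (Suc n) x + (1 - q ^ n) * qHermite q (n - 1) x"
  by (cases n) auto

text \<open>The recurrence moves the factor \<open>2 * cos \<phi>\<close> from one polynomial to the
  other, lowering the second index until only the integral against \<open>H_0\<close> is left. The
  first index moves both ways, hence the generalisation over m.\<close>

theorem qHermite_orthogonal:
  "integral {0..pi} (\<lambda>\<phi>. weight \<phi> * (qHermite q m (cos \<phi>) * qHermite q n (cos \<phi>)))
    = 2 * pi * (qfac n * of_bool (m = n))"
proof (induction n arbitrary: m rule: less_induct)
  case (less n)
  let ?H = "\<lambda>n \<phi>. qHermite q n (cos \<phi>)"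
  let ?I = "\<lambda>m n. integral {0..pi} (\<lambda>\<phi>. weight \<phi> * (?H m \<phi> * ?H n \<phi>))"
  show ?case
  proof (cases n)
    case 0
    then show ?thesis using integral_weight_qHermite[of m] by simp
  next
    case (Suc l)
    have int: "(\<lambda>\<phi>. weight \<phi> * (?H m \<phi> * ?H n \<phi>)) integrable_on {0..pi}" for m n
      by (intro integrable_continuous_interval continuous_intros continuous_on_weight continuous_on_qHermite_cos)
    have "?H m \<phi> * ?H (Suc l) \<phi> =
        ?H (Suc m) \<phi> * ?H l \<phi> + (1 - q ^ m) * (?H (m - 1) \<phi> * ?H l \<phi>) - (1 - q ^ l) * (?H m \<phi> * ?H (l - 1) \<phi>)" for \<phi>
    proof -
      have "?H m \<phi> * (2 * cos \<phi> * ?H l \<phi>) = (2 * cos \<phi> * ?H m \<phi>) * ?H l \<phi>"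
        by simp
      then show ?thesis
        unfolding qHermite_three_term by (simp add: algebra_simps)
    qed
    then have "weight \<phi> * (?H m \<phi> * ?H (Suc l) \<phi>) = weight \<phi> * (?H (Suc m) \<phi> * ?H l \<phi>)
        + (1 - q ^ m) * (weight \<phi> * (?H (m - 1) \<phi> * ?H l \<phi>)) - (1 - q ^ l) * (weight \<phi> * (?H m \<phi> * ?H (l - 1) \<phi>))" for \<phi>
      by (simp only: distrib_left right_diff_distrib mult.left_commute)
    then have "?I m (Suc l) = integral {0..pi} (\<lambda>\<phi>. weight \<phi> * (?H (Suc m) \<phi> * ?H l \<phi>)
        + (1 - q ^ m) * (weight \<phi> * (?H (m - 1) \<phi> * ?H l \<phi>)) - (1 - q ^ l) * (weight \<phi> * (?H m \<phi> * ?H (l - 1) \<phi>)))"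
      by simp
    also have "\<dots> = ?I (Suc m) l + (1 - q ^ m) * ?I (m - 1) l - (1 - q ^ l) * ?I m (l - 1)"
      by (intro integral_unique has_integral_diff has_integral_add has_integral_mult_right integrable_integral int)
    also have "(1 - q ^ l) * ?I m (l - 1) = (1 - q ^ l) * (2 * pi * (qfac (l - 1) * of_bool (m = l - 1)))"
      using less[of "l - 1" m] by (cases l) (auto simp: Suc)
    also have "?I (Suc m) l = 2 * pi * (qfac l * of_bool (Suc m = l))"
      using less[of l] by (simp add: Suc)
    also have "?I (m - 1) l = 2 * pi * (qfac l * of_bool (m - 1 = l))"
      using less[of l] by (simp add: Suc)
    finally have "?I m (Suc l) = 2 * pi * (qfac l * of_bool (Suc m = l))
        + (1 - q ^ m) * (2 * pi * (qfac l * of_bool (m - 1 = l)))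
        - (1 - q ^ l) * (2 * pi * (qfac (l - 1) * of_bool (m = l - 1)))" .
    \<comment> \<open>When m = 0 or l = 0 the truncated predecessor may match wrongly, but then its
      coefficient 1 - q^0 is zero.\<close>
    also have "\<dots> = 2 * pi * (qfac (Suc l) * of_bool (m = Suc l))"
      by (cases l; cases m) (auto simp: qfac_Suc of_bool_def)
    finally show ?thesis by (simp only: Suc)
  qed
qed


subsection \<open>The Poisson kernel\<close>

lemma qpoch_nonzero:
  assumes "norm A < 1"
  shows "qpoch q A \<noteq> 0"
proof
  assume "qpoch q A = 0"
  then obtain k where "A * of_real (q ^ k) = 1"
    using qpoch_eq_0D by blast
  then have "norm A * q ^ k = 1"
    using q_gt0 by (metis norm_mult norm_of_real norm_one abs_of_pos zero_less_power)
  moreover have "norm A * q ^ k \<le> norm A * 1"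
    using q_gt0 q_lt1 by (intro mult_left_mono power_le_one) auto
  ultimately show False using assms by simp
qed

section \<open>Coefficients of the Poisson series\<close>

definition poisson_coeff :: "real \<Rightarrow> real \<Rightarrow> nat \<Rightarrow> real" where
  "poisson_coeff x y n = qHermite q n x * qHermite q n y / qfac n"

definition poisson :: "real \<Rightarrow> real \<Rightarrow> real \<Rightarrow> real" where
  "poisson x y t = (\<Sum>n. poisson_coeff x y n * t ^ n)"

text \<open>The product of the four factors 1 - t e^(i(\<plusminus>\<theta>\<plusminus>\<phi>)),
  expanded as a real polynomial in t, x and y.\<close>

definition poisson_factor :: "real \<Rightarrow> real \<Rightarrow> real \<Rightarrow> real" where
  "poisson_factor x y t = 1 - 4 * x * y * t + (4 * x\<^sup>2 + 4 * y\<^sup>2 - 2) * t\<^sup>2 - 4 * x * y * t ^ 3 + t ^ 4"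

text \<open>The coefficient of \<open>t\<^sup>n\<close> in \<open>t\<^sup>k\<close> times the Poisson series.\<close>
definition shifted_coeff :: "real \<Rightarrow> real \<Rightarrow> nat \<Rightarrow> nat \<Rightarrow> real" where
  "shifted_coeff x y k n = (if n < k then 0 else poisson_coeff x y (n - k))"

text \<open>\<open>A\<close>, \<open>B\<close>, \<open>H2\<close>, \<open>H3\<close>,
  \<open>H4\<close> stand for \<open>H_m\<close> to \<open>H_(m+4)\<close> at x, primes for the same
  at y, and \<open>Q\<close> for q^(m+1). This is the coefficient recurrence below with denominators
  cleared, proved by eliminating the highest index three times.\<close>

lemma poisson_recurrence_numerator:
  fixes x y Q A A' B B' :: real
  defines "d1 \<equiv> 1 - Q" and "d2 \<equiv> 1 - q * Q" and "d3 \<equiv> 1 - q * (q * Q)"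
  assumes H2: "H2 = 2 * x * B - d1 * A" "H2' = 2 * y * B' - d1 * A'"
    and H3: "H3 = 2 * x * H2 - d2 * B" "H3' = 2 * y * H2' - d2 * B'"
    and H4: "H4 = 2 * x * H3 - d3 * H2" "H4' = 2 * y * H3' - d3 * H2'"
  shows "H4 * H4' - 4 * x * y * (H3 * H3') + (4 * x\<^sup>2 + 4 * y\<^sup>2 - 2 + (1 + q) * (q * Q)) * d3 * (H2 * H2')
    - 4 * x * y * d2 * d3 * (B * B') + d1\<^sup>2 * d2 * d3 * (A * A') = 0" (is "?N = 0")
proof -
  have "?N = d3 * ((4 * x\<^sup>2 + 4 * y\<^sup>2 - 2 + (1 + q) * (q * Q) + d3) * (H2 * H2')
      - 2 * x * H3 * H2' - 2 * y * H2 * H3' - 4 * x * y * d2 * (B * B') + d1\<^sup>2 * d2 * (A * A'))"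
    unfolding H4 by (simp add: algebra_simps power2_eq_square)
  also have "\<dots> = d3 * d2 * (d1\<^sup>2 * (A * A') - (H2 - 2 * x * B) * (H2' - 2 * y * B'))"
    unfolding H3 unfolding d2_def d3_def by (simp add: algebra_simps power2_eq_square)
  also have "\<dots> = 0"
    unfolding H2 by (simp add: power2_eq_square)
  finally show ?thesis .
qed

text \<open>Compares coefficients of t^n in D(t) P(t) = (1 - t^2)(1 - q t^2) P(q t), with D the
  quartic \<open>poisson_factor\<close> and P the Poisson series. Truncated exponents only meet
  vanishing coefficients.\<close>

lemma poisson_coeff_recurrence:
  fixes x y :: real
  defines "f \<equiv> shifted_coeff x y"
  shows "f 0 n - 4 * x * y * f 1 n + (4 * x\<^sup>2 + 4 * y\<^sup>2 - 2) * f 2 n - 4 * x * y * f 3 n + f 4 n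
    = q ^ n * f 0 n - (1 + q) * (q ^ (n - 2) * f 2 n) + q * (q ^ (n - 4) * f 4 n)"
proof -
  note f = f_def shifted_coeff_def poisson_coeff_def
  have q1: "1 - q \<noteq> 0" using q_lt1 by simp
  have q2: "1 - q * q \<noteq> 0" using q_power_Suc_neq_1[of 1] by simp
  have q3: "1 - q * (q * q) \<noteq> 0" using q_power_Suc_neq_1[of 2] by (simp add: power2_eq_square)
  have H: "qHermite q (Suc (Suc n)) w = 2 * w * qHermite q (Suc n) w - (1 - q ^ Suc n) * qHermite q n w" for n w
    by simp
  \<comment> \<open>Below n = 4 some shifted coefficients are zero, so these cases are separate from
    the generic one.\<close>
  consider "n = 0" | "n = Suc 0" | "n = Suc (Suc 0)" | "n = Suc (Suc (Suc 0))"
    | m where "n = Suc (Suc (Suc (Suc m)))"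
    by (metis not0_implies_Suc)
  then show ?thesis
  proof cases
    case 1
    then show ?thesis by (simp add: f)
  next
    case 2
    with q1 show ?thesis by (simp add: f qfac_Suc field_simps)
  next
    case 3
    have "(1 - q * q) * f 0 n - 4 * x * y * f 1 n + (4 * x\<^sup>2 + 4 * y\<^sup>2 - 2 + (1 + q)) * f 2 n = 0"
      using q1 q2 unfolding 3 by (simp add: f qfac_Suc divide_simps power2_eq_square) (simp add: algebra_simps)
    moreover have "f 3 n = 0" "f 4 n = 0" "q ^ n = q * q" "q ^ (n - 2) = 1"
      by (simp_all add: f 3)
    ultimately show ?thesis by (simp add: algebra_simps)
  next
    case 4
    define d2 d3 d4 where "d2 = 1 - q" and "d3 = 1 - q * q" and "d4 = 1 - q * (q * q)"
    define C where "C = 4 * x\<^sup>2 + 4 * y\<^sup>2 - 2 + (1 + q) * q"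
    have d0: "d2 \<noteq> 0" "d3 \<noteq> 0" "d4 \<noteq> 0"
      using q1 q2 q3 by (simp_all add: d2_def d3_def d4_def)
    have F: "qfac 1 = d2" "qfac 2 = d3 * d2" "qfac 3 = d4 * d3 * d2"
      by (simp_all add: d2_def d3_def d4_def numeral_eq_Suc qfac_Suc)
    let ?H = "qHermite q"
    \<comment> \<open>The numerator identity at m = -1: \<open>Q = 1\<close>, and
      \<open>A = 0\<close>, \<open>B = 1\<close> play the roles of \<open>H_(-1)\<close> and
      \<open>H_0\<close>.\<close>
    have N: "?H 3 x * ?H 3 y - 4 * x * y * (?H 2 x * ?H 2 y) + C * d3 * (?H 1 x * ?H 1 y)
      - 4 * x * y * d2 * d3 = 0" (is "?N = 0")
      using poisson_recurrence_numerator[of "?H 1 x" x 1 1 0 "?H 1 y" y 1 0 "?H 2 x" "?H 2 y" "?H 3 x" "?H 3 y"]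
      by (simp add: numeral_eq_Suc d2_def d3_def C_def mult.assoc)
    have f0: "f 0 n = ?H 3 x * ?H 3 y / qfac 3" "f 1 n = ?H 2 x * ?H 2 y / qfac 2"
      "f 2 n = ?H 1 x * ?H 1 y / qfac 1" "f 3 n = 1" "f 4 n = 0"
      by (simp_all add: f 4 numeral_eq_Suc)
    have "d4 * f 0 n - 4 * x * y * f 1 n + C * f 2 n - 4 * x * y * f 3 n = ?N / (d3 * d2)"
      unfolding f0 F using d0 by (simp add: divide_simps)
    then have "d4 * f 0 n - 4 * x * y * f 1 n + C * f 2 n - 4 * x * y * f 3 n = 0"
      unfolding N by simp
    moreover have "d4 = 1 - q ^ n" "C = 4 * x\<^sup>2 + 4 * y\<^sup>2 - 2 + (1 + q) * q ^ (n - 2)"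
      by (simp_all add: d4_def C_def 4)
    ultimately show ?thesis
      unfolding f0(5) by (simp add: algebra_simps)
  next
    case 5
    define d where "d = (\<lambda>j. 1 - q ^ (m + j))"
    let ?H = "\<lambda>j. qHermite q (m + j)"
    \<comment> \<open>The total coefficient of \<open>f 2 n\<close> once the right-hand side has
      been moved to the left.\<close>
    define C where "C = 4 * x\<^sup>2 + 4 * y\<^sup>2 - 2 + (1 + q) * (q * q ^ Suc m)"
    have d0: "d 1 \<noteq> 0" "d 2 \<noteq> 0" "d 3 \<noteq> 0" "d 4 \<noteq> 0"
      using q_power_Suc_neq_1[of m] q_power_Suc_neq_1[of "Suc m"] q_power_Suc_neq_1[of "Suc (Suc m)"]
        q_power_Suc_neq_1[of "Suc (Suc (Suc m))"]
      by (simp_all add: d_def numeral_eq_Suc)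
    have F: "qfac (m + 1) = d 1 * qfac m" "qfac (m + 2) = d 2 * d 1 * qfac m"
        "qfac (m + 3) = d 3 * d 2 * d 1 * qfac m" "qfac (m + 4) = d 4 * d 3 * d 2 * d 1 * qfac m"
      by (simp_all add: d_def numeral_eq_Suc qfac_Suc)
    have N: "?H 4 x * ?H 4 y - 4 * x * y * (?H 3 x * ?H 3 y) + C * d 3 * (?H 2 x * ?H 2 y)
      - 4 * x * y * d 2 * d 3 * (?H 1 x * ?H 1 y) + (d 1)\<^sup>2 * d 2 * d 3 * (?H 0 x * ?H 0 y) = 0"
      (is "?N = 0")
      using poisson_recurrence_numerator[of "?H 2 x" x "?H 1 x" "q ^ Suc m" "?H 0 x" "?H 2 y" y "?H 1 y" "?H 0 y" "?H 3 x" "?H 3 y" "?H 4 x" "?H 4 y"]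
      by (simp add: numeral_eq_Suc d_def C_def mult.assoc)
    have f0: "f 0 n = ?H 4 x * ?H 4 y / qfac (m + 4)" "f 1 n = ?H 3 x * ?H 3 y / qfac (m + 3)"
      "f 2 n = ?H 2 x * ?H 2 y / qfac (m + 2)" "f 3 n = ?H 1 x * ?H 1 y / qfac (m + 1)"
      "f 4 n = ?H 0 x * ?H 0 y / qfac m"
      by (simp_all add: f 5 numeral_eq_Suc)
    \<comment> \<open>The common denominator (q;q)_(m+3); the extra factor of (q;q)_(m+4) cancels
      against \<open>d 4\<close>.\<close>
    define P where "P = d 3 * d 2 * d 1 * qfac m"
    have P: "d 4 * f 0 n * P = ?H 4 x * ?H 4 y" "f 1 n * P = ?H 3 x * ?H 3 y"
      "f 2 n * P = d 3 * (?H 2 x * ?H 2 y)" "f 3 n * P = d 3 * d 2 * (?H 1 x * ?H 1 y)"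
      "f 4 n * P = d 3 * d 2 * d 1 * (?H 0 x * ?H 0 y)"
      unfolding f0 F P_def using d0 by simp_all
    have "(d 4 * f 0 n - 4 * x * y * f 1 n + C * f 2 n - 4 * x * y * f 3 n + d 1 * f 4 n) * P =
      d 4 * f 0 n * P - 4 * x * y * (f 1 n * P) + C * (f 2 n * P) - 4 * x * y * (f 3 n * P) + d 1 * (f 4 n * P)"
      by (simp only: ring_distribs mult.assoc)
    also have "\<dots> = ?N"
      unfolding P power2_eq_square by (simp only: mult_ac)
    also have "\<dots> = 0"
      by (rule N)
    finally have A: "d 4 * f 0 n - 4 * x * y * f 1 n + C * f 2 n - 4 * x * y * f 3 n + d 1 * f 4 n = 0"
      using d0 by (simp add: P_def)
    have e: "d 4 = 1 - q ^ n" "C = 4 * x\<^sup>2 + 4 * y\<^sup>2 - 2 + (1 + q) * q ^ (n - 2)" "d 1 = 1 - q * q ^ (n - 4)"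
      by (simp_all add: d_def C_def 5 numeral_eq_Suc)
    show ?thesis
      using A unfolding e by (simp add: algebra_simps)
  qed
qed

text \<open>(n+1)^2 is at most (n+1)(n+2), the coefficient of the second derivative of the geometric
  series.\<close>

lemma summable_poisson_bound:
  assumes "\<bar>t\<bar> < 1"
  shows "summable (\<lambda>n. (real (Suc n) / qfac_inf\<^sup>2)\<^sup>2 / qfac_inf * \<bar>t\<bar> ^ n)"
proof -
  have d1: "summable (\<lambda>n. diffs (\<lambda>_. 1) n * x ^ n)" if "norm x < 1" for x :: real
    by (rule termdiff_converges[OF that]) (simp add: summable_geometric)
  have d2: "summable (\<lambda>n. diffs (diffs (\<lambda>_. 1)) n * \<bar>t\<bar> ^ n)"
    by (rule termdiff_converges[OF _ d1]) (use assms in auto)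
  have "summable (\<lambda>n. (real (Suc n))\<^sup>2 * \<bar>t\<bar> ^ n)"
  proof (rule summable_comparison_test'[OF d2])
    fix n
    have "(real (Suc n))\<^sup>2 \<le> diffs (diffs (\<lambda>_. 1)) n"
      by (simp add: diffs_def power2_eq_square algebra_simps)
    then show "norm ((real (Suc n))\<^sup>2 * \<bar>t\<bar> ^ n) \<le> diffs (diffs (\<lambda>_. 1)) n * \<bar>t\<bar> ^ n"
      by (simp add: abs_mult mult_right_mono del: of_nat_Suc)
  qed
  from summable_mult[OF this, of "1 / (qfac_inf\<^sup>2)\<^sup>2 / qfac_inf"] show ?thesis
    by (simp add: power_divide mult_ac)
qed

lemma abs_poisson_coeff_le:
  "\<bar>poisson_coeff (cos \<phi>) (cos \<theta>) n\<bar> \<le> (real (Suc n) / qfac_inf\<^sup>2)\<^sup>2 / qfac_inf"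
proof -
  have "\<bar>qHermite q n (cos \<phi>) * qHermite q n (cos \<theta>)\<bar> \<le> (real (Suc n) / qfac_inf\<^sup>2)\<^sup>2"
    unfolding abs_mult power2_eq_square[of "_ / _"]
    by (intro mult_mono abs_qHermite_cos_le) auto
  then show ?thesis
    unfolding poisson_coeff_def abs_divide using qfac_inf_pos qfac_pos[of n] qfac_inf_le_qfac[of n]
    by (intro frac_le) auto
qed

section \<open>Functional equation and product form of the Poisson kernel\<close>

lemma poisson_sums:
  assumes "\<bar>t\<bar> < 1"
  shows "(\<lambda>n. poisson_coeff (cos \<phi>) (cos \<theta>) n * t ^ n) sums poisson (cos \<phi>) (cos \<theta>) t"
  unfolding poisson_def
proof (rule summable_sums, rule summable_comparison_test'[OF summable_poisson_bound[OF assms]])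
  fix n
  show "norm (poisson_coeff (cos \<phi>) (cos \<theta>) n * t ^ n) \<le> (real (Suc n) / qfac_inf\<^sup>2)\<^sup>2 / qfac_inf * \<bar>t\<bar> ^ n"
    unfolding real_norm_def abs_mult power_abs by (rule mult_right_mono[OF abs_poisson_coeff_le]) simp
qed

text \<open>Multiplication by t^k shifts coefficients, so both sides are power series in t whose
  coefficients agree by \<open>poisson_coeff_recurrence\<close>.\<close>

lemma poisson_functional_equation:
  assumes t: "\<bar>t\<bar> < 1"
  shows "poisson_factor (cos \<phi>) (cos \<theta>) t * poisson (cos \<phi>) (cos \<theta>) t =
    (1 - t\<^sup>2) * (1 - q * t\<^sup>2) * poisson (cos \<phi>) (cos \<theta>) (q * t)"
proof -
  define x y where "x = cos \<phi>" and "y = cos \<theta>"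
  define f where "f = shifted_coeff x y"
  let ?S = "poisson x y"
  have "\<bar>q * t\<bar> \<le> 1 * \<bar>t\<bar>"
    unfolding abs_mult using q_gt0 q_lt1 by (intro mult_right_mono) auto
  then have qt: "\<bar>q * t\<bar> < 1" using t by simp
  have L: "(\<lambda>n. f k n * t ^ n) sums (t ^ k * ?S t)" for k
    unfolding f_def shifted_coeff_def x_def y_def by (rule sums_power_shift[OF poisson_sums[OF t]])
  have R: "(\<lambda>n. q ^ (n - k) * f k n * t ^ n) sums (t ^ k * ?S (q * t))" for k
  proof -
    have "(\<lambda>n. (q ^ n * poisson_coeff x y n) * t ^ n) sums ?S (q * t)"
      using poisson_sums[OF qt, of \<phi> \<theta>] by (simp add: x_def y_def power_mult_distrib mult_ac)
    from sums_power_shift[OF this, of k] show ?thesis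
      by (simp add: f_def shifted_coeff_def if_distrib cong: if_cong)
  qed
  have l: "(\<lambda>n. f 0 n * t ^ n - 4 * x * y * (f 1 n * t ^ n) + (4 * x\<^sup>2 + 4 * y\<^sup>2 - 2) * (f 2 n * t ^ n)
      - 4 * x * y * (f 3 n * t ^ n) + f 4 n * t ^ n)
    sums (t ^ 0 * ?S t - 4 * x * y * (t ^ 1 * ?S t) + (4 * x\<^sup>2 + 4 * y\<^sup>2 - 2) * (t ^ 2 * ?S t)
      - 4 * x * y * (t ^ 3 * ?S t) + t ^ 4 * ?S t)" (is "?l sums ?L")
    by (intro sums_add sums_diff sums_mult L)
  have r: "(\<lambda>n. q ^ (n - 0) * f 0 n * t ^ n - (1 + q) * (q ^ (n - 2) * f 2 n * t ^ n) + q * (q ^ (n - 4) * f 4 n * t ^ n))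
    sums (t ^ 0 * ?S (q * t) - (1 + q) * (t ^ 2 * ?S (q * t)) + q * (t ^ 4 * ?S (q * t)))" (is "?r sums ?R")
    by (intro sums_add sums_diff sums_mult R)
  have lr: "?l = ?r"
  proof
    fix n
    have "?l n = (f 0 n - 4 * x * y * f 1 n + (4 * x\<^sup>2 + 4 * y\<^sup>2 - 2) * f 2 n - 4 * x * y * f 3 n + f 4 n) * t ^ n"
      by (simp add: algebra_simps)
    also have "\<dots> = ?r n"
      unfolding f_def poisson_coeff_recurrence by (simp add: algebra_simps)
    finally show "?l n = ?r n" .
  qed
  have "?L = ?R"
    using l unfolding lr by (rule sums_unique2[OF _ r])
  then show ?thesis
    unfolding x_def[symmetric] y_def[symmetric]
    by (simp add: poisson_factor_def algebra_simps power2_eq_square power4_eq_xxxx)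
qed

text \<open>Each use of the functional equation at t q^N contributes the two factors with exponents
  2N and 2N + 1.\<close>

lemma poisson_iterate:
  assumes t: "\<bar>t\<bar> < 1"
  shows "(\<Prod>k<N. poisson_factor (cos \<phi>) (cos \<theta>) (t * q ^ k)) * poisson (cos \<phi>) (cos \<theta>) t =
    (\<Prod>k<2 * N. 1 - t\<^sup>2 * q ^ k) * poisson (cos \<phi>) (cos \<theta>) (t * q ^ N)"
proof (induction N)
  case (Suc N)
  let ?P = "poisson (cos \<phi>) (cos \<theta>)" and ?D = "poisson_factor (cos \<phi>) (cos \<theta>)"
  have "\<bar>t * q ^ N\<bar> \<le> \<bar>t\<bar> * 1"
    unfolding abs_mult using q_gt0 q_lt1 by (intro mult_left_mono) (auto simp: power_abs power_le_one)
  then have "?D (t * q ^ N) * ?P (t * q ^ N) =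
      (1 - (t * q ^ N)\<^sup>2) * (1 - q * (t * q ^ N)\<^sup>2) * ?P (q * (t * q ^ N))"
    using t by (intro poisson_functional_equation) simp
  moreover have "(q ^ N)\<^sup>2 = q ^ (2 * N)"
    by (simp add: power_mult mult.commute[of 2])
  ultimately have step: "?D (t * q ^ N) * ?P (t * q ^ N) =
      (1 - t\<^sup>2 * q ^ (2 * N)) * (1 - t\<^sup>2 * q ^ Suc (2 * N)) * ?P (t * q ^ Suc N)"
    by (simp add: power_mult_distrib mult_ac)
  have "(\<Prod>k<Suc N. ?D (t * q ^ k)) * ?P t = ?D (t * q ^ N) * ((\<Prod>k<N. ?D (t * q ^ k)) * ?P t)"
    by simp
  also have "\<dots> = (\<Prod>k<2 * N. 1 - t\<^sup>2 * q ^ k) * (?D (t * q ^ N) * ?P (t * q ^ N))"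
    unfolding Suc by simp
  also have "\<dots> = (\<Prod>k<2 * Suc N. 1 - t\<^sup>2 * q ^ k) * ?P (t * q ^ Suc N)"
    unfolding step by simp
  finally show ?case .
qed simp

text \<open>Opposite angles pair to real quadratics; the sum and product of cos(\<theta>+\<phi>) and
  cos(\<theta>-\<phi>) then recover the quartic.\<close>

lemma poisson_factor_cis:
  "of_real (poisson_factor (cos \<phi>) (cos \<theta>) t) =
    (1 - of_real t * cis (\<theta> + \<phi>)) * (1 - of_real t * cis (\<theta> - \<phi>)) *
    (1 - of_real t * cis (- \<theta> + \<phi>)) * (1 - of_real t * cis (- \<theta> - \<phi>))"
proof -
  have pair: "(1 - of_real t * cis \<alpha>) * (1 - of_real t * cis (- \<alpha>)) = of_real (1 - 2 * t * cos \<alpha> + t\<^sup>2)" for \<alpha>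
  proof -
    have "cis \<alpha> + cis (- \<alpha>) = of_real (2 * cos \<alpha>)" and "cis \<alpha> * cis (- \<alpha>) = 1"
      by (simp_all add: complex_eq_iff cis_mult)
    moreover have "(1 - of_real t * cis \<alpha>) * (1 - of_real t * cis (- \<alpha>)) =
        1 - of_real t * (cis \<alpha> + cis (- \<alpha>)) + (of_real t)\<^sup>2 * (cis \<alpha> * cis (- \<alpha>))"
      by (simp add: algebra_simps power2_eq_square)
    ultimately show ?thesis by (simp add: mult_ac)
  qed
  have sum: "cos (\<theta> + \<phi>) + cos (\<theta> - \<phi>) = 2 * (cos \<phi> * cos \<theta>)"
    by (simp add: cos_add cos_diff)
  have prod: "cos (\<theta> + \<phi>) * cos (\<theta> - \<phi>) = (cos \<phi>)\<^sup>2 + (cos \<theta>)\<^sup>2 - 1"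
    unfolding cos_times_cos using cos_double_cos[of \<theta>] cos_double_cos[of \<phi>] by simp
  have "poisson_factor (cos \<phi>) (cos \<theta>) t =
      (1 + t\<^sup>2)\<^sup>2 - 2 * t * (1 + t\<^sup>2) * (2 * (cos \<phi> * cos \<theta>)) + 4 * t\<^sup>2 * ((cos \<phi>)\<^sup>2 + (cos \<theta>)\<^sup>2 - 1)"
    by (simp add: poisson_factor_def power2_eq_square power3_eq_cube power4_eq_xxxx algebra_simps)
  also have "\<dots> = (1 - 2 * t * cos (\<theta> + \<phi>) + t\<^sup>2) * (1 - 2 * t * cos (\<theta> - \<phi>) + t\<^sup>2)"
    unfolding sum[symmetric] prod[symmetric] by (simp add: power2_eq_square algebra_simps)
  finally have "of_real (poisson_factor (cos \<phi>) (cos \<theta>) t) =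
    ((1 - of_real t * cis (\<theta> + \<phi>)) * (1 - of_real t * cis (- (\<theta> + \<phi>)))) *
    ((1 - of_real t * cis (\<theta> - \<phi>)) * (1 - of_real t * cis (- (\<theta> - \<phi>))))"
    unfolding pair by (simp only: of_real_mult)
  moreover have "- (\<theta> + \<phi>) = - \<theta> - \<phi>" "- (\<theta> - \<phi>) = - \<theta> + \<phi>" by simp_all
  ultimately show ?thesis by (simp only: mult_ac)
qed

text \<open>Let N tend to infinity in \<open>poisson_iterate\<close>: the argument t q^N tends to 0,
  where the series is continuous with value 1, and the finite products become infinite ones.\<close>

theorem poisson_kernel:
  assumes t: "\<bar>t\<bar> < 1"
  shows "of_real (poisson (cos \<phi>) (cos \<theta>) t) =
    qpoch q (of_real (t\<^sup>2)) /
      (qpoch q (of_real t * cis (\<theta> + \<phi>)) * qpoch q (of_real t * cis (\<theta> - \<phi>)) *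
       qpoch q (of_real t * cis (- \<theta> + \<phi>)) * qpoch q (of_real t * cis (- \<theta> - \<phi>)))"
    (is "?S = _ / ?Q")
proof -
  let ?P = "poisson (cos \<phi>) (cos \<theta>)" and ?D = "poisson_factor (cos \<phi>) (cos \<theta>)"
  have "(\<lambda>N. \<Prod>k<N. 1 - of_real (t * q ^ k) * cis \<alpha>) \<longlonglongrightarrow> qpoch q (of_real t * cis \<alpha>)" for \<alpha>
    using qpoch_LIMSEQ[of "of_real t * cis \<alpha>"] by (simp add: mult_ac)
  then have D: "(\<lambda>N. \<Prod>k<N. of_real (?D (t * q ^ k))) \<longlonglongrightarrow> ?Q"
    unfolding poisson_factor_cis prod.distrib by (intro tendsto_mult)
  have "isCont ?P 0"
    unfolding poisson_def
    by (rule isCont_powser[of _ "1 / 2"]) (use poisson_sums[of "1 / 2" \<phi> \<theta>] in \<open>auto simp: sums_iff\<close>)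
  moreover have "(\<lambda>N. t * q ^ N) \<longlonglongrightarrow> t * 0"
    using q_gt0 q_lt1 by (intro tendsto_intros LIMSEQ_realpow_zero) auto
  ultimately have "(\<lambda>N. ?P (t * q ^ N)) \<longlonglongrightarrow> ?P 0"
    by (intro isCont_tendsto_compose[of 0 ?P]) auto
  moreover have "?P 0 = 1"
    unfolding poisson_def powser_zero by (simp add: poisson_coeff_def)
  ultimately have P: "(\<lambda>N. of_real (?P (t * q ^ N))) \<longlonglongrightarrow> (1 :: complex)"
    using tendsto_of_real by fastforce
  have "(\<lambda>N. \<Prod>k<2 * N. 1 - of_real (t\<^sup>2) * of_real (q ^ k)) \<longlonglongrightarrow> qpoch q (of_real (t\<^sup>2))"
    by (rule filterlim_compose[OF qpoch_LIMSEQ mult_nat_left_at_top]) simp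
  from tendsto_mult[OF this P]
  have "(\<lambda>N. of_real ((\<Prod>k<2 * N. 1 - t\<^sup>2 * q ^ k) * ?P (t * q ^ N))) \<longlonglongrightarrow> qpoch q (of_real (t\<^sup>2))"
    by simp
  moreover have "(\<lambda>N. of_real ((\<Prod>k<N. ?D (t * q ^ k)) * ?P t)) \<longlonglongrightarrow> ?Q * ?S"
    using tendsto_mult[OF D tendsto_const[of ?S]] by simp
  ultimately have "?Q * ?S = qpoch q (of_real (t\<^sup>2))"
    unfolding poisson_iterate[OF t] using LIMSEQ_unique by blast
  moreover have "?Q \<noteq> 0"
    using t by (simp add: qpoch_nonzero norm_mult)
  ultimately show ?thesis
    by (simp add: field_simps)
qed

text \<open>Orthogonality kills every term of the Poisson series but m = n, where the norm
  \<open>qfac n\<close> cancels the denominator.\<close>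

theorem has_integral_weight_poisson:
  assumes t: "\<bar>t\<bar> < 1"
  shows "((\<lambda>\<phi>. weight \<phi> * qHermite q n (cos \<phi>) * poisson (cos \<phi>) (cos \<theta>) t)
    has_integral 2 * pi * t ^ n * qHermite q n (cos \<theta>)) {0..pi}"
proof -
  let ?w = "\<lambda>\<phi>. weight \<phi> * qHermite q n (cos \<phi>)"
  let ?p = "\<lambda>m \<phi>. poisson_coeff (cos \<phi>) (cos \<theta>) m * t ^ m"
  let ?M = "\<lambda>m. (real (Suc m) / qfac_inf\<^sup>2)\<^sup>2 / qfac_inf * \<bar>t\<bar> ^ m"
  have w: "continuous_on {0..pi} ?w"
    by (intro continuous_intros continuous_on_weight continuous_on_qHermite_cos)
  then have "bounded (?w ` {0..pi})"
    by (intro compact_imp_bounded compact_continuous_image) auto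
  then obtain B where B: "\<And>\<phi>. \<phi> \<in> {0..pi} \<Longrightarrow> \<bar>?w \<phi>\<bar> \<le> B"
    unfolding bounded_iff by (auto simp del: atLeastAtMost_iff)
  have c: "continuous_on {0..pi} (\<lambda>\<phi>. ?w \<phi> * ?p m \<phi>)" for m
    unfolding poisson_coeff_def by (intro continuous_intros w continuous_on_qHermite_cos) simp
  have bound: "norm (?w \<phi> * ?p m \<phi>) \<le> B * ?M m" if "\<phi> \<in> {0..pi}" for m \<phi>
    unfolding real_norm_def abs_mult[of "?w \<phi>"] abs_mult[of "poisson_coeff _ _ _"] power_abs
  proof (intro mult_mono B that abs_poisson_coeff_le)
    show "0 \<le> B" using B[OF that] by linarith
  qed (use qfac_inf_pos in auto)
  note W = Weierstrass_m_test_integral[of 0 pi "\<lambda>m \<phi>. ?w \<phi> * ?p m \<phi>",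
      OF c bound summable_mult[OF summable_poisson_bound[OF t]]]
  have sum: "(\<Sum>m. ?w \<phi> * ?p m \<phi>) = ?w \<phi> * poisson (cos \<phi>) (cos \<theta>) t" for \<phi>
    unfolding poisson_def using poisson_sums[OF t] by (intro suminf_mult) (auto simp: sums_iff)
  have "integral {0..pi} (\<lambda>\<phi>. ?w \<phi> * ?p m \<phi>) = (if m = n then 2 * pi * t ^ n * qHermite q n (cos \<theta>) else 0)" for m
  proof -
    have "integral {0..pi} (\<lambda>\<phi>. ?w \<phi> * ?p m \<phi>) = integral {0..pi} (\<lambda>\<phi>. (qHermite q m (cos \<theta>) * t ^ m / qfac m) *
        (weight \<phi> * (qHermite q m (cos \<phi>) * qHermite q n (cos \<phi>))))"
      by (simp add: poisson_coeff_def mult_ac)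
    also have "\<dots> = (qHermite q m (cos \<theta>) * t ^ m / qfac m) * (2 * pi * (qfac n * of_bool (m = n)))"
      by (simp only: integral_mult_right qHermite_orthogonal)
    finally show ?thesis by simp
  qed
  with W(2) have "(\<lambda>m. if m = n then 2 * pi * t ^ n * qHermite q n (cos \<theta>) else 0) sums
      integral {0..pi} (\<lambda>\<phi>. ?w \<phi> * poisson (cos \<phi>) (cos \<theta>) t)"
    by (simp only: sum)
  then have "integral {0..pi} (\<lambda>\<phi>. ?w \<phi> * poisson (cos \<phi>) (cos \<theta>) t) = 2 * pi * t ^ n * qHermite q n (cos \<theta>)"
    by (rule sums_unique2[OF _ sums_single[of n "\<lambda>_. 2 * pi * t ^ n * qHermite q n (cos \<theta>)"]])
  moreover have "(\<lambda>\<phi>. ?w \<phi> * poisson (cos \<phi>) (cos \<theta>) t) integrable_on {0..pi}"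
    using W(1) unfolding sum by (rule integrable_continuous_interval)
  ultimately show ?thesis
    by (simp only: has_integral_integrable_integral)
qed


subsection \<open>The eigenfunction property and its derivative\<close>

lemma wH_cos:
  assumes "0 < \<phi>" "\<phi> < pi"
  shows "wH q (cos \<phi>) = of_real (weight \<phi> / (2 * pi * sin \<phi>))"
proof -
  have "sqrt (1 - (cos \<phi>)\<^sup>2) = sin \<phi>"
    using assms sin_gt_zero[of \<phi>] by (simp add: sin_squared_eq[symmetric])
  moreover have "exp (2 * \<i> * of_real \<phi>) = cis (2 * \<phi>)" "exp (- 2 * \<i> * of_real \<phi>) = cis (- 2 * \<phi>)"
    by (simp_all add: cis_conv_exp mult_ac)
  ultimately show ?thesis
    using assms unfolding wH_def
    by (simp add: Let_def arccos_cos qpochs_def weight_eq_qpoch qpoch_q mult.assoc)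
qed

text \<open>A zero needs a vanishing factor, and the index of that factor determines
  \<open>cos \<phi>\<close>. Hence the denominators in \<open>K\<close> vanish only on a null set,
  whatever the nonzero c.\<close>

lemma countable_zeros_qpoch:
  assumes "A \<noteq> 0"
  shows "countable {\<phi> \<in> {0..pi}. qpoch q (A * cis \<phi>) = 0 \<or> qpoch q (A * cis (- \<phi>)) = 0}"
proof (rule countable_subset)
  show "{\<phi> \<in> {0..pi}. qpoch q (A * cis \<phi>) = 0 \<or> qpoch q (A * cis (- \<phi>)) = 0}
    \<subseteq> range (\<lambda>k. arccos (Re (1 / (A * of_real (q ^ k)))))"
  proof
    fix \<phi> assume "\<phi> \<in> {\<phi> \<in> {0..pi}. qpoch q (A * cis \<phi>) = 0 \<or> qpoch q (A * cis (- \<phi>)) = 0}"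
    then have \<phi>: "0 \<le> \<phi>" "\<phi> \<le> pi" and "\<exists>s \<in> {\<phi>, - \<phi>}. qpoch q (A * cis s) = 0"
      by auto
    then obtain s k where s: "s \<in> {\<phi>, - \<phi>}" and "A * cis s * of_real (q ^ k) = 1"
      using qpoch_eq_0D by blast
    then have "cis s = 1 / (A * of_real (q ^ k))"
      using assms q_gt0 by (simp add: field_simps)
    then have "Re (1 / (A * of_real (q ^ k))) = cos s"
      by (metis cis.simps(1))
    also have "\<dots> = cos \<phi>"
      using s by auto
    finally have "arccos (Re (1 / (A * of_real (q ^ k)))) = \<phi>"
      using \<phi> by (simp only: arccos_cos)
    then show "\<phi> \<in> range (\<lambda>k. arccos (Re (1 / (A * of_real (q ^ k)))))"
      by (metis rangeI)
  qed
qed simp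

lemma countable_zeros_h:
  assumes "A \<noteq> 0" "B \<noteq> 0"
  shows "countable {\<phi> \<in> {0..pi}. h q (cos \<phi>) [A, B] = 0}"
proof (rule countable_subset)
  show "countable ({\<phi> \<in> {0..pi}. qpoch q (A * cis \<phi>) = 0 \<or> qpoch q (A * cis (- \<phi>)) = 0} \<union>
      {\<phi> \<in> {0..pi}. qpoch q (B * cis \<phi>) = 0 \<or> qpoch q (B * cis (- \<phi>)) = 0})"
    by (intro countable_Un countable_zeros_qpoch assms)
qed (auto simp: h_cos)

text \<open>The factor \<open>h\<close> in f cancels the one in the kernel off a null set. What
  remains is the weight times the Poisson kernel at t = q^(a/2), where t^2 = q^a.\<close>

theorem K_qHermite:
  fixes n :: nat
  assumes a: "a > 0" and c: "c \<noteq> 0"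
  defines "f \<equiv> \<lambda>x. h q x [- 1 / c, - c * of_real q] * of_real (qHermite q n x)"
  shows "K q a c f (cos \<theta>) =
    of_real (q powr (a * (a - 3) / 4)) * (of_real (1 - q) / (2 * c)) powr (of_real a)
    * h q (cos \<theta>) [- c * of_real (q powr (1 - a / 2)), - of_real (q powr (a / 2)) / c]
    * of_real (q powr (real n * a / 2) * qHermite q n (cos \<theta>))"
proof -
  define t where "t = q powr (a / 2)"
  \<comment> \<open>The angle that \<open>K\<close> itself uses; it has the cosine of \<theta>,
    which is all that the result depends on.\<close>
  define \<psi> where "\<psi> = arccos (cos \<theta>)"
  have t: "\<bar>t\<bar> < 1" and t2: "t\<^sup>2 = q powr a"
    using q_gt0 q_lt1 a by (simp_all add: t_def powr01_less_one power2_eq_square flip: powr_add)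
  have tn: "t ^ n = q powr (real n * a / 2)"
    using q_gt0 by (simp add: t_def powr_realpow[symmetric] powr_powr mult_ac)
  have cos_\<psi>: "cos \<psi> = cos \<theta>"
    by (simp add: \<psi>_def cos_arccos)
  let ?Z = "{\<phi> \<in> {0..pi}. h q (cos \<phi>) [- 1 / c, - c * of_real q] = 0}"
  let ?F = "\<lambda>\<phi>. wH q (cos \<phi>) * qpoch q (of_real (q powr a)) * f (cos \<phi>) * of_real (sin \<phi>)
         / (h q (cos \<phi>) [of_real t * exp (\<i> * of_real \<psi>), of_real t * exp (- \<i> * of_real \<psi>)]
            * h q (cos \<phi>) [- 1 / c, - c * of_real q])"
  let ?G = "\<lambda>\<phi>. 1 / (2 * pi) * (weight \<phi> * qHermite q n (cos \<phi>) * poisson (cos \<phi>) (cos \<psi>) t)"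
  have int: "((\<lambda>\<phi>. complex_of_real (?G \<phi>)) has_integral
      of_real (1 / (2 * pi) * (2 * pi * t ^ n * qHermite q n (cos \<psi>)))) {0..pi}"
    by (intro has_integral_of_real has_integral_mult_right has_integral_weight_poisson t)
  \<comment> \<open>At the endpoints \<open>wH\<close> divides by zero, so they are removed along
    with the zeros of \<open>h\<close>.\<close>
  have neg: "negligible (?Z \<union> {0, pi})"
    using c q_gt0 by (intro negligible_countable countable_Un countable_zeros_h) auto
  have eq: "?F \<phi> = of_real (?G \<phi>)" if "\<phi> \<in> {0..pi} - (?Z \<union> {0, pi})" for \<phi>
  proof -
    have \<phi>: "0 < \<phi>" "\<phi> < pi" and nz: "h q (cos \<phi>) [- 1 / c, - c * of_real q] \<noteq> 0"
      using that by auto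
    then have s: "sin \<phi> \<noteq> 0"
      using sin_gt_zero[of \<phi>] by simp
    have e: "exp (\<i> * of_real \<psi>) = cis \<psi>" "exp (- \<i> * of_real \<psi>) = cis (- \<psi>)"
      by (simp_all add: cis_conv_exp)
    have "complex_of_real (poisson (cos \<phi>) (cos \<psi>) t) = qpoch q (of_real (q powr a)) /
        h q (cos \<phi>) [of_real t * exp (\<i> * of_real \<psi>), of_real t * exp (- \<i> * of_real \<psi>)]"
      unfolding poisson_kernel[OF t] h_cos e t2 mult.assoc cis_mult by simp
    then show ?thesis
      using nz s by (simp add: f_def wH_cos[OF \<phi>] mult_ac)
  qed
  have "(?F has_integral of_real (1 / (2 * pi) * (2 * pi * t ^ n * qHermite q n (cos \<psi>)))) {0..pi}"
    by (rule has_integral_spike[OF neg eq int])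
  then have "integral {0..pi} ?F = of_real (q powr (real n * a / 2) * qHermite q n (cos \<theta>))"
    by (simp add: integral_unique cos_\<psi> tn)
  then show ?thesis
    unfolding K_def Let_def \<psi>_def t_def by (simp only:)
qed

section \<open>Theta functions and their derivatives\<close>

definition theta :: "complex \<Rightarrow> complex" where
  "theta u = qpoch q (- u) * qpoch q (- of_real q / u)"

text \<open>A partial theta function, entire in v. In the bilateral series the indices k \<ge> 1 sum
  to \<open>u * theta_half u\<close> and the indices k \<le> 0 to
  \<open>theta_half (1 / u)\<close>.\<close>

definition theta_half :: "complex \<Rightarrow> complex" where
  "theta_half v = (\<Sum>k. of_real (q ^ (Suc k choose 2)) * v ^ k)"

definition theta_half' :: "complex \<Rightarrow> complex" where
  "theta_half' v = (\<Sum>k. diffs (\<lambda>k. of_real (q ^ (Suc k choose 2))) k * v ^ k)"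

lemma theta_half_sums: "(\<lambda>k. of_real (q ^ (Suc k choose 2)) * v ^ k) sums theta_half v"
  unfolding theta_half_def by (rule summable_sums[OF summable_norm_cancel[OF summable_norm_theta]])

lemma theta_half_deriv: "(theta_half has_field_derivative theta_half' v) (at v)"
  unfolding theta_half_def theta_half'_def
  by (rule termdiffs_strong_converges_everywhere) (rule summable_norm_cancel[OF summable_norm_theta])

text \<open>The extra factor v restores the powers lost by differentiation. The general type allows
  the real instance at \<open>norm v\<close>, which yields absolute summability.\<close>

lemma diffs_theta_sums:
  fixes v :: "'a :: {real_normed_field, banach}"
  shows "(\<lambda>k. of_nat k * of_real (q ^ (Suc k choose 2)) * v ^ k) sums
    (v * (\<Sum>k. diffs (\<lambda>k. of_real (q ^ (Suc k choose 2))) k * v ^ k))"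
proof -
  have "summable (\<lambda>k. diffs (\<lambda>k. of_real (q ^ (Suc k choose 2))) k * v ^ k)"
    by (rule termdiff_converges_all) (rule summable_norm_cancel[OF summable_norm_theta])
  note sums_mult[OF diffs_equiv[OF this], of v]
  moreover have "v * (of_nat k * of_real (q ^ (Suc k choose 2)) * v ^ (k - Suc 0)) =
      of_nat k * of_real (q ^ (Suc k choose 2)) * v ^ k" for k
    by (cases k) auto
  ultimately show ?thesis by (simp only:)
qed

lemmas theta_half'_sums = diffs_theta_sums[where 'a = complex, folded theta_half'_def]

lemma summable_norm_diffs_theta:
  fixes v :: "'a :: real_normed_field"
  shows "summable (\<lambda>k. norm (of_nat k * of_real (q ^ (Suc k choose 2)) * v ^ k))"
  using sums_summable[OF diffs_theta_sums[of "norm v"]] q_gt0 by (simp add: norm_mult norm_power)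

lemma theta_eq:
  assumes "u \<noteq> 0"
  shows "theta u = (u * theta_half u + theta_half (1 / u)) / of_real qfac_inf"
proof -
  have "(\<lambda>k. u * (of_real (q ^ (Suc k choose 2)) * u ^ k) + of_real (q ^ (Suc k choose 2)) * (1 / u) ^ k)
      sums (u * theta_half u + theta_half (1 / u))"
    by (intro sums_add sums_mult theta_half_sums)
  moreover have "u * (of_real (q ^ (Suc k choose 2)) * u ^ k) + of_real (q ^ (Suc k choose 2)) * (1 / u) ^ k =
      of_real (q ^ (Suc k choose 2)) * (u ^ Suc k + 1 / u ^ k)" for k
    by (simp add: power_divide algebra_simps)
  ultimately have "of_real qfac_inf * theta u = u * theta_half u + theta_half (1 / u)"
    using sums_unique2[OF triple_product[OF assms]] by (simp add: theta_def mult.assoc)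
  then show ?thesis
    using qfac_inf_pos by (simp add: field_simps)
qed

text \<open>Split at k \<ge> 1, with k = j + 1, and k \<le> 0, with k = -j. The weights j + 1 and -j
  produce the series and its derivative in the first half and only the derivative in the
  second.\<close>

lemma logTheta_eq:
  assumes u: "u \<noteq> 0"
  shows "logTheta q u = of_real (ln q) / (2 * of_real qfac_inf) *
    (u * theta_half u + u * (u * theta_half' u) - 1 / u * theta_half' (1 / u))"
proof -
  let ?c = "\<lambda>k. of_real (q ^ (Suc k choose 2)) :: complex"
  let ?L = "of_real (ln q) / (2 * of_real qfac_inf) :: complex"
  let ?g = "\<lambda>k::int. of_real (q powi (k * (k - 1) div 2)) * u powi k / qpoch q (of_real q)
     * of_real (of_int k * ln q / 2)"
  have pos: "?g (int k + 1) = ?L * (u * (?c k * u ^ k) + u * (of_nat k * ?c k * u ^ k))" for k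
  proof -
    have "(int k + 1) * (int k + 1 - 1) div 2 = int (Suc k choose 2)"
    proof -
      have "(int k + 1) * (int k + 1 - 1) = int (Suc k * (Suc k - 1))"
        by (simp add: algebra_simps)
      then show ?thesis by (simp only: choose_two zdiv_int of_nat_numeral)
    qed
    moreover have "u powi (int k + 1) = u ^ Suc k"
      using power_int_of_nat[of u "Suc k"] by (simp add: add.commute)
    ultimately show ?thesis
      by (simp add: power_int_of_nat qpoch_q algebra_simps add_divide_distrib)
  qed
  have neg: "?g (- int k) = ?L * (- (of_nat k * ?c k * (1 / u) ^ k))" for k
  proof -
    have "(- int k) * (- int k - 1) div 2 = int (Suc k choose 2)"
    proof -
      have "(- int k) * (- int k - 1) = int (Suc k * (Suc k - 1))"
        by (simp add: algebra_simps)
      then show ?thesis by (simp only: choose_two zdiv_int of_nat_numeral)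
    qed
    moreover have "u powi (- int k) = (1 / u) ^ k"
      by (simp add: power_int_minus power_divide inverse_eq_divide)
    ultimately show ?thesis
      by (simp add: power_int_of_nat qpoch_q mult_ac)
  qed
  \<comment> \<open>Absolute convergence is what passes from an ordered series to the unordered sum
    in \<open>logTheta\<close>.\<close>
  have "((\<lambda>k. ?g (int k + 1)) has_sum ?L * (u * theta_half u + u * (u * theta_half' u))) UNIV"
  proof (rule norm_summable_imp_has_sum)
    show "(\<lambda>k. ?g (int k + 1)) sums (?L * (u * theta_half u + u * (u * theta_half' u)))"
      unfolding pos by (intro sums_mult sums_add theta_half_sums theta_half'_sums)
    show "summable (\<lambda>k. norm (?g (int k + 1)))"
      unfolding pos norm_mult[of ?L]
    proof (rule summable_mult, rule summable_comparison_test')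
      show "summable (\<lambda>k. norm u * norm (?c k * u ^ k) + norm u * norm (of_nat k * ?c k * u ^ k))"
        by (intro summable_add summable_mult summable_norm_theta summable_norm_diffs_theta)
    qed (simp add: norm_triangle_le norm_mult)
  qed
  then have P: "(?g has_sum ?L * (u * theta_half u + u * (u * theta_half' u))) {1..}"
    by (subst (asm) has_sum_reindex_bij_witness[where T = "{1..}" and h = ?g and j = "\<lambda>k. int k + 1" and i = "\<lambda>k. nat (k - 1)"]) auto
  have "((\<lambda>k. ?g (- int k)) has_sum ?L * (- (1 / u * theta_half' (1 / u)))) UNIV"
  proof (rule norm_summable_imp_has_sum)
    show "(\<lambda>k. ?g (- int k)) sums (?L * (- (1 / u * theta_half' (1 / u))))"
      unfolding neg by (intro sums_mult sums_minus theta_half'_sums)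
    show "summable (\<lambda>k. norm (?g (- int k)))"
      unfolding neg norm_mult[of ?L] norm_minus_cancel
      by (intro summable_mult summable_norm_diffs_theta)
  qed
  then have N: "(?g has_sum ?L * (- (1 / u * theta_half' (1 / u)))) {..0}"
    by (subst (asm) has_sum_reindex_bij_witness[where T = "{..0}" and h = ?g and j = "\<lambda>k. - int k" and i = "\<lambda>k. nat (- k)"]) auto
  have "{1..} \<inter> {..0} = ({} :: int set)" and un: "{1..} \<union> {..0} = (UNIV :: int set)"
    by auto
  from has_sum_Un_disjoint[OF P N this(1)] have "(?g has_sum (?L * (u * theta_half u + u * (u * theta_half' u)) +
      ?L * (- (1 / u * theta_half' (1 / u))))) UNIV"
    unfolding un .
  from infsumI[OF this] show ?thesis
    unfolding logTheta_def by (rule trans) (simp add: algebra_simps)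
qed

text \<open>The operator u d/du inserts a factor k into each bilateral term, whereas
  \<open>logTheta\<close> carries k (ln q) / 2; hence the quotient 2 / ln q.\<close>

theorem theta_has_field_derivative:
  assumes u: "u \<noteq> 0"
  shows "(theta has_field_derivative 2 * logTheta q u / (u * of_real (ln q))) (at u)"
proof -
  let ?T = "\<lambda>u. (u * theta_half u + theta_half (1 / u)) / of_real qfac_inf"
  have inv: "((\<lambda>u. theta_half (1 / u)) has_field_derivative theta_half' (1 / u) * (- (1 / u\<^sup>2))) (at u)"
    by (rule DERIV_chain2[OF theta_half_deriv]) (use u in \<open>auto intro!: derivative_eq_intros simp: power2_eq_square\<close>)
  have "(?T has_field_derivative
      ((1 * theta_half u + theta_half' u * u) + theta_half' (1 / u) * (- (1 / u\<^sup>2))) / of_real qfac_inf) (at u)"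
    by (intro DERIV_cdivide DERIV_add DERIV_mult DERIV_ident theta_half_deriv inv)
  moreover have "((1 * theta_half u + theta_half' u * u) + theta_half' (1 / u) * (- (1 / u\<^sup>2))) / of_real qfac_inf
      = 2 * logTheta q u / (u * of_real (ln q))"
    unfolding logTheta_eq[OF u] using u q_gt0 q_lt1 qfac_inf_pos
    by (simp add: field_simps power2_eq_square)
  ultimately have "(?T has_field_derivative 2 * logTheta q u / (u * of_real (ln q))) (at u)"
    by simp
  \<comment> \<open>The series formula is available away from 0, hence on a neighbourhood of
    u.\<close>
  moreover have "eventually (\<lambda>v. ?T v = theta v) (nhds u)"
    using t1_space_nhds[OF u] by eventually_elim (simp add: theta_eq)
  ultimately show ?thesis
    using u by (subst (asm) DERIV_cong_ev[OF refl _ refl]) (auto simp: theta_eq)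
qed

text \<open>Along u = b q^(s/2) the chain rule factor u (ln q) / 2 cancels the quotient
  exactly.\<close>

lemma theta_exp_has_field_derivative:
  assumes b: "b \<noteq> 0"
  shows "((\<lambda>s. theta (b * exp (s * (of_real (ln q) / 2)))) has_field_derivative
    logTheta q (b * exp (s * (of_real (ln q) / 2)))) (at s)"
proof -
  let ?u = "\<lambda>s. b * exp (s * (of_real (ln q) / 2))"
  have u: "?u s \<noteq> 0" using b by simp
  have "(?u has_field_derivative ?u s * (of_real (ln q) / 2)) (at s)"
    by (auto intro!: derivative_eq_intros)
  from DERIV_chain2[OF theta_has_field_derivative[OF u] this]
  have "((\<lambda>s. theta (?u s)) has_field_derivative
      2 * logTheta q (?u s) / (?u s * of_real (ln q)) * (?u s * (of_real (ln q) / 2))) (at s)" .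
  moreover have "2 * logTheta q (?u s) / (?u s * of_real (ln q)) * (?u s * (of_real (ln q) / 2)) = logTheta q (?u s)"
    using u q_gt0 q_lt1 by simp
  ultimately show ?thesis by (simp only:)
qed

end

section \<open>Differentiating the eigenvalue in the order a\<close>

theorem theorem4p2:
  fixes q a \<theta> :: real and c z :: complex and n :: nat and f :: "real \<Rightarrow> complex"
  assumes "0 < q" and "q < 1" and "a > 0" and "c \<noteq> 0"
    and z_def: "z = exp (\<i> * of_real \<theta>)"
    and f_def: "f = (\<lambda>x. h q x [- 1 / c, - c * of_real q] * of_real (qHermite q n x))"
  shows "(Jquot q a c f (cos \<theta>) \<longlongrightarrow> J q a c f (cos \<theta>)) (at_right 0) \<and>
    J q a c f (cos \<theta>) =
      of_real (q powr (a * (a - 3) / 4 + real n * a / 2)) * (of_real (1 - q) / (2 * c)) powr (of_real a)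
      * (h q (cos \<theta>) [- c * of_real (q powr (1 - a / 2)), - of_real (q powr (a / 2)) / c]
           * Ln (of_real ((1 - q) * q powr ((real n + a) / 2 - 3 / 4)) / (2 * c))
         + logTheta q (z * of_real (q powr (a / 2)) / c)
           * qpochs q [- of_real (q powr (a / 2)) / (c * z), - c * z * of_real (q powr (1 - a / 2))]
         + logTheta q (of_real (q powr (a / 2)) / (z * c))
           * qpochs q [- of_real (q powr (a / 2)) * z / c, - c * of_real (q powr (1 - a / 2)) / z])
      * of_real (qHermite q n (cos \<theta>))"
proof -
  interpret qseries q
    using assms(1,2) by unfold_locales
  define w where "w = complex_of_real (1 - q) / (2 * c)"
  define l where "l = complex_of_real (ln q)"
  define Hn where "Hn = complex_of_real (qHermite q n (cos \<theta>))"
  \<comment> \<open>The order is extended to complex s, so that complex differentiation applies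
    throughout.\<close>
  define u1 u2 where "u1 = (\<lambda>s. z / c * exp (s * (l / 2)))" and "u2 = (\<lambda>s. 1 / (z * c) * exp (s * (l / 2)))"
  define E where "E = (\<lambda>s. exp (l * (s * (s - 3) / 4 + of_nat n * s / 2)) * exp (s * Ln w))"
  define G where "G = (\<lambda>s. E s * (theta (u1 s) * theta (u2 s)) * Hn)"
  define G' where "G' = E (of_real a) * (theta (u1 (of_real a)) * theta (u2 (of_real a)) *
      (l * ((of_nat n + of_real a) / 2 - 3 / 4) + Ln w)
      + logTheta q (u1 (of_real a)) * theta (u2 (of_real a)) + logTheta q (u2 (of_real a)) * theta (u1 (of_real a))) * Hn"
  have z: "z = cis \<theta>" "cis (- \<theta>) = 1 / z" "z \<noteq> 0"
    by (simp_all add: z_def cis_conv_exp exp_minus inverse_eq_divide)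
  have w0: "w \<noteq> 0"
    using assms(2,4) by (simp add: w_def)
  have q_powr: "complex_of_real (q powr x) = exp (of_real x * l)" for x
    using q_gt0 by (simp add: l_def powr_def exp_of_real[symmetric])
  have u: "u1 (of_real s) = z * of_real (q powr (s / 2)) / c" "u2 (of_real s) = of_real (q powr (s / 2)) / (z * c)" for s
    by (simp_all add: u1_def u2_def q_powr)
  have shift: "complex_of_real (q powr (1 - s / 2)) = of_real q / of_real (q powr (s / 2))" for s
    using q_gt0 by (simp add: powr_diff)
  have theta1: "theta (u1 (of_real s)) = qpochs q [- of_real (q powr (s / 2)) * z / c, - c * of_real (q powr (1 - s / 2)) / z]"
    and theta2: "theta (u2 (of_real s)) = qpochs q [- of_real (q powr (s / 2)) / (c * z), - c * z * of_real (q powr (1 - s / 2))]" for s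
    unfolding theta_def u shift using assms(4) z(3) by (simp_all add: qpochs_def mult_ac)
  \<comment> \<open>Each factor with argument -u is regrouped with the one with argument -q/u, for u
    = \<open>u1\<close> and u = \<open>u2\<close>.\<close>
  have h_theta: "h q (cos \<theta>) [- c * of_real (q powr (1 - s / 2)), - of_real (q powr (s / 2)) / c]
      = theta (u1 (of_real s)) * theta (u2 (of_real s))" for s
    unfolding h_cos z(2) z(1)[symmetric] theta1 theta2 by (simp add: qpochs_def mult_ac)
  have E: "E (of_real s) = of_real (q powr (s * (s - 3) / 4 + real n * s / 2)) * w powr of_real s" for s
    using w0 by (simp add: E_def q_powr powr_def[of w] mult_ac)
  \<comment> \<open>Positive orders suffice: a right-hand quotient at a > 0 only sees a and a + d
    with d > 0.\<close>
  have K: "K q s c f (cos \<theta>) = G (of_real s)" if "s > 0" for s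
    unfolding f_def K_qHermite[OF that assms(4)] h_theta G_def E w_def[symmetric] Hn_def
    by (simp add: powr_add)
  have "(G has_field_derivative G') (at (of_real a))"
  proof -
    have d1: "((\<lambda>s. theta (u1 s)) has_field_derivative logTheta q (u1 s)) (at s)" for s
      unfolding u1_def l_def using theta_exp_has_field_derivative[of "z / c"] z(3) assms(4) by simp
    have d2: "((\<lambda>s. theta (u2 s)) has_field_derivative logTheta q (u2 s)) (at s)" for s
      unfolding u2_def l_def using theta_exp_has_field_derivative[of "1 / (z * c)"] z(3) assms(4) by simp
    \<comment> \<open>The exponent s (s - 3) / 4 + n s / 2 has derivative (n + s) / 2 - 3 / 4, the
      power of q inside the logarithm.\<close>
    have dE: "(E has_field_derivative E s * (l * ((of_nat n + s) / 2 - 3 / 4) + Ln w)) (at s)" for s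
      unfolding E_def by (auto intro!: derivative_eq_intros simp: field_simps)
    show ?thesis
      unfolding G_def G'_def
      by (rule DERIV_cong[OF DERIV_cmult_right[OF DERIV_mult[OF dE DERIV_mult[OF d1 d2]]]])
        (simp add: algebra_simps)
  qed
  then have "(\<lambda>h. (G (of_real a + h) - G (of_real a)) / h) \<midarrow>0\<rightarrow> G'"
    by (simp add: DERIV_def)
  \<comment> \<open>Restricts the complex difference quotient to positive real increments.\<close>
  moreover have "filterlim complex_of_real (at 0) (at_right 0)"
    unfolding filterlim_at
    by (auto intro!: tendsto_eq_intros simp: eventually_at_filter)
  ultimately have "((\<lambda>d. (G (of_real a + of_real d) - G (of_real a)) / of_real d) \<longlongrightarrow> G') (at_right 0)"
    by (rule filterlim_compose)
  moreover have "eventually (\<lambda>d. (G (of_real a + of_real d) - G (of_real a)) / of_real d = Jquot q a c f (cos \<theta>) d) (at_right 0)"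
    using eventually_at_right_less[of "0 :: real"]
    by eventually_elim (use assms(3) in \<open>simp add: Jquot_def K\<close>)
  ultimately have lim: "(Jquot q a c f (cos \<theta>) \<longlongrightarrow> G') (at_right 0)"
    by (rule Lim_transform_eventually)
  then have J: "J q a c f (cos \<theta>) = G'"
    unfolding J_def by (intro tendsto_Lim) simp_all
  have "Ln (of_real ((1 - q) * q powr ((real n + a) / 2 - 3 / 4)) / (2 * c)) =
      Ln (of_real (q powr ((real n + a) / 2 - 3 / 4)) * w)"
    by (simp add: w_def mult_ac)
  \<comment> \<open>A positive real factor leaves the argument unchanged, so the principal logarithm
    splits without a multiple of 2 pi i.\<close>
  also have "\<dots> = l * ((of_nat n + of_real a) / 2 - 3 / 4) + Ln w"
    using w0 q_gt0 by (subst Ln_times_of_real) (simp_all add: Ln_of_real ln_powr l_def mult.commute)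
  finally have Ln: "Ln (of_real ((1 - q) * q powr ((real n + a) / 2 - 3 / 4)) / (2 * c)) = \<dots>" .
  show ?thesis
    using lim unfolding J Ln h_theta theta1[symmetric] theta2[symmetric] u[symmetric] w_def[symmetric] Hn_def[symmetric] E[symmetric] G'_def
    by simp
qed

end
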